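(* Let $X$ be a locally paracompact Hausdorff space and $\mathcal{E}\to X$ an $n$-homogeneous (F) Banach bundle. Then $$\inf\{d_{b\mathrm{BM}}(\mathcal{E},\mathcal{E}')\ :\ \mathcal{E}'\to X \text{ an } n\text{-homogeneous (F) Hilbert bundle}\}\le \tfrac12\log n.$$
   Context: Fix a ground field $\mathbb{F}\in\{\mathbb{R},\mathbb{C}\}$. A Banach bundle over $X$ is a continuous open surjection $\pi:\mathcal{E}\to X$ with a Banach-space structure on each fiber $\mathcal{E}_x=\pi^{-1}(x)$ such that scalar multiplication and fiberwise addition are continuous, the norm $\mathcal{E}\to\mathbb{R}_{\ge0}$ is continuous ((F) bundle), and for every $x$ the sets $\{p:\pi(p)\in U,\ \|p\|<\varepsilon\}$ ($U\ni x$ open, $\varepsilon>0$) form a fundamental system of neighbourhoods of $0_x$. A Hilbert bundle is a Banach bundle whose fiber norms come from inner products; $n$-homogeneous means all fibers have dimension $n$. A space is locally paracompact if every point has a closed paracompact neighbourhood. $\Gamma_b(\mathcal{E})$ is the Banach $C_b(X)$-module of bounded continuous sections with the supremum norm. A renorming $\mathcal{E}\to\mathcal{E}'$ is a homeomorphism $\Phi$ of total spaces commuting with the projections and linear on each fiber. The bounded Banach–Mazur distance is $d_{b\mathrm{BM}}(\mathcal{E},\mathcal{E}')=\log\inf_T\|T\|\,\|T^{-1}\|$, the infimum over all maps $T:\Gamma_b(\mathcal{E})\to\Gamma_b(\mathcal{E}')$, $T(s)=\Phi\circ s$, induced by renormings $\Phi$ for which $T$ is a bijection $\Gamma_b(\mathcal{E})\to\Gamma_b(\mathcal{E}')$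 that is bounded with bounded inverse (these are $C_b(X)$-module isomorphisms); the infimum of the empty set is $+\infty$. *)

theory Defs
  imports "HOL-Analysis.Analysis"
begin

definition paracompact_space :: "'a topology \<Rightarrow> bool" where
  "paracompact_space X \<longleftrightarrow>
     (\<forall>\<U>. (\<forall>U\<in>\<U>. openin X U) \<and> \<Union>\<U> = topspace X \<longrightarrow>
        (\<exists>\<V>. (\<forall>V\<in>\<V>. openin X V) \<and> \<Union>\<V> = topspace X \<and>
             (\<forall>V\<in>\<V>. \<exists>U\<in>\<U>. V \<subseteq> U) \<and> locally_finite_in X \<V>))"

definition locally_paracompact :: "'a topology \<Rightarrow> bool" where
  "locally_paracompact X \<longleftrightarrow>
     (\<forall>x\<in>topspace X. \<exists>N. closedin X N \<and> x \<in> X interior_of N \<and>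
                          paracompact_space (subtopology X N))"

text \<open>A bundle datum: base space, total space, projection, and the fibrewise
  vector operations (meaningful on each fibre), zero section and norm.\<close>
record ('x, 'e, 'k) bbundle =
  base  :: "'x topology"
  tot   :: "'e topology"
  proj  :: "'e \<Rightarrow> 'x"
  badd  :: "'e \<Rightarrow> 'e \<Rightarrow> 'e"
  bscale :: "'k \<Rightarrow> 'e \<Rightarrow> 'e"
  bzero :: "'x \<Rightarrow> 'e"
  bnorm :: "'e \<Rightarrow> real"

definition fibre :: "('x, 'e, 'k) bbundle \<Rightarrow> 'x \<Rightarrow> 'e set" where
  "fibre E x = {p \<in> topspace (tot E). proj E p = x}"

definition banach_structure ::
  "'e set \<Rightarrow> ('e \<Rightarrow> 'e \<Rightarrow> 'e) \<Rightarrow> ('k::real_normed_field \<Rightarrow> 'e \<Rightarrow> 'e) \<Rightarrow> 'e \<Rightarrow> ('e \<Rightarrow> real) \<Rightarrow> bool"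
  where
  "banach_structure S add sc z nrm \<longleftrightarrow>
     z \<in> S \<and>
     (\<forall>p\<in>S. \<forall>q\<in>S. add p q \<in> S) \<and>
     (\<forall>a. \<forall>p\<in>S. sc a p \<in> S) \<and>
     (\<forall>p\<in>S. \<forall>q\<in>S. \<forall>r\<in>S. add (add p q) r = add p (add q r)) \<and>
     (\<forall>p\<in>S. \<forall>q\<in>S. add p q = add q p) \<and>
     (\<forall>p\<in>S. add z p = p) \<and>
     (\<forall>p\<in>S. \<exists>q\<in>S. add p q = z) \<and>
     (\<forall>a. \<forall>p\<in>S. \<forall>q\<in>S. sc a (add p q) = add (sc a p) (sc a q)) \<and>
     (\<forall>a b. \<forall>p\<in>S. sc (a + b) p = add (sc a p) (sc b p)) \<and>
     (\<forall>a b. \<forall>p\<in>S. sc (a * b) p = sc a (sc b p)) \<and>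
     (\<forall>p\<in>S. sc 1 p = p) \<and>
     (\<forall>p\<in>S. 0 \<le> nrm p) \<and>
     (\<forall>p\<in>S. nrm p = 0 \<longleftrightarrow> p = z) \<and>
     (\<forall>a. \<forall>p\<in>S. nrm (sc a p) = norm a * nrm p) \<and>
     (\<forall>p\<in>S. \<forall>q\<in>S. nrm (add p q) \<le> nrm p + nrm q) \<and>
     (\<forall>f::nat \<Rightarrow> 'e. (\<forall>m. f m \<in> S) \<and>
          (\<forall>\<epsilon>>0. \<exists>N. \<forall>m\<ge>N. \<forall>k\<ge>N. nrm (add (f m) (sc (-1) (f k))) < \<epsilon>) \<longrightarrow>
          (\<exists>L\<in>S. (\<lambda>m. nrm (add (f m) (sc (-1) L))) \<longlonglongrightarrow> 0))"

definition banach_bundle :: "('x, 'e, 'k::real_normed_field) bbundle \<Rightarrow> bool" where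
  "banach_bundle E \<longleftrightarrow>
     continuous_map (tot E) (base E) (proj E) \<and>
     open_map (tot E) (base E) (proj E) \<and>
     proj E ` topspace (tot E) = topspace (base E) \<and>
     (\<forall>x\<in>topspace (base E). bzero E x \<in> fibre E x \<and>
         banach_structure (fibre E x) (badd E) (bscale E) (bzero E x) (bnorm E)) \<and>
     continuous_map (prod_topology euclidean (tot E)) (tot E) (\<lambda>(a, p). bscale E a p) \<and>
     continuous_map (subtopology (prod_topology (tot E) (tot E))
                       {(p, q). proj E p = proj E q})
                    (tot E) (\<lambda>(p, q). badd E p q) \<and>
     continuous_map (tot E) euclideanreal (bnorm E) \<and>
     (\<forall>x\<in>topspace (base E).
        (\<forall>U \<epsilon>. openin (base E) U \<and> x \<in> U \<and> \<epsilon> > 0 \<longrightarrow>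
           bzero E x \<in> (tot E) interior_of
              {p \<in> topspace (tot E). proj E p \<in> U \<and> bnorm E p < \<epsilon>}) \<and>
        (\<forall>W. openin (tot E) W \<and> bzero E x \<in> W \<longrightarrow>
           (\<exists>U \<epsilon>. openin (base E) U \<and> x \<in> U \<and> \<epsilon> > 0 \<and>
              {p \<in> topspace (tot E). proj E p \<in> U \<and> bnorm E p < \<epsilon>} \<subseteq> W)))"

text \<open>Hilbert bundle: each fibre norm comes from an inner product (sesquilinear
  with respect to the conjugation \<open>cj\<close>; \<open>cj = id\<close> for real scalars,
  \<open>cj = cnj\<close> for complex scalars).\<close>
definition hilbert_bundle ::
  "('k::real_normed_field \<Rightarrow> 'k) \<Rightarrow> ('x, 'e, 'k) bbundle \<Rightarrow> bool" where
  "hilbert_bundle cj E \<longleftrightarrow> banach_bundle E \<and>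
     (\<forall>x\<in>topspace (base E). \<exists>ip :: 'e \<Rightarrow> 'e \<Rightarrow> 'k.
        (\<forall>p\<in>fibre E x. \<forall>q\<in>fibre E x. \<forall>r\<in>fibre E x.
            ip (badd E p q) r = ip p r + ip q r) \<and>
        (\<forall>a. \<forall>p\<in>fibre E x. \<forall>q\<in>fibre E x. ip (bscale E a p) q = a * ip p q) \<and>
        (\<forall>p\<in>fibre E x. \<forall>q\<in>fibre E x. ip q p = cj (ip p q)) \<and>
        (\<forall>p\<in>fibre E x. ip p p = of_real ((bnorm E p)\<^sup>2)))"

fun fsum :: "('e \<Rightarrow> 'e \<Rightarrow> 'e) \<Rightarrow> 'e \<Rightarrow> (nat \<Rightarrow> 'e) \<Rightarrow> nat \<Rightarrow> 'e" where
  "fsum add z f 0 = z"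
| "fsum add z f (Suc n) = add (fsum add z f n) (f n)"

definition homogeneous :: "nat \<Rightarrow> ('x, 'e, 'k::real_normed_field) bbundle \<Rightarrow> bool" where
  "homogeneous n E \<longleftrightarrow>
     (\<forall>x\<in>topspace (base E). \<exists>b :: nat \<Rightarrow> 'e. (\<forall>i<n. b i \<in> fibre E x) \<and>
        (\<forall>v\<in>fibre E x. \<exists>!c :: nat \<Rightarrow> 'k. (\<forall>i\<ge>n. c i = 0) \<and>
             v = fsum (badd E) (bzero E x) (\<lambda>i. bscale E (c i) (b i)) n))"

definition bsections :: "('x, 'e, 'k) bbundle \<Rightarrow> ('x \<Rightarrow> 'e) set" where
  "bsections E = {s. continuous_map (base E) (tot E) s \<and>
                     (\<forall>x\<in>topspace (base E). proj E (s x) = x) \<and>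
                     (\<forall>x. x \<notin> topspace (base E) \<longrightarrow> s x = undefined) \<and>
                     (\<exists>B. \<forall>x\<in>topspace (base E). bnorm E (s x) \<le> B)}"

text \<open>Supremum norm (the \<open>0\<close> only matters when the base is empty).\<close>
definition supnorm :: "('x, 'e, 'k) bbundle \<Rightarrow> ('x \<Rightarrow> 'e) \<Rightarrow> real" where
  "supnorm E s = Sup (insert 0 ((\<lambda>x. bnorm E (s x)) ` topspace (base E)))"

definition opnorm ::
  "('x, 'e, 'k) bbundle \<Rightarrow> ('x, 'f, 'k) bbundle \<Rightarrow> (('x \<Rightarrow> 'e) \<Rightarrow> ('x \<Rightarrow> 'f)) \<Rightarrow> real" where
  "opnorm E E' T = Sup (insert 0 {supnorm E' (T s) | s. s \<in> bsections E \<and> supnorm E s \<le> 1})"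

definition bounded_op ::
  "('x, 'e, 'k) bbundle \<Rightarrow> ('x, 'f, 'k) bbundle \<Rightarrow> (('x \<Rightarrow> 'e) \<Rightarrow> ('x \<Rightarrow> 'f)) \<Rightarrow> bool" where
  "bounded_op E E' T \<longleftrightarrow> (\<exists>C. \<forall>s\<in>bsections E. supnorm E' (T s) \<le> C * supnorm E s)"

definition renorming ::
  "('x, 'e, 'k) bbundle \<Rightarrow> ('x, 'f, 'k) bbundle \<Rightarrow> ('e \<Rightarrow> 'f) \<Rightarrow> bool" where
  "renorming E E' \<Phi> \<longleftrightarrow>
     base E' = base E \<and>
     homeomorphic_map (tot E) (tot E') \<Phi> \<and>
     (\<forall>p\<in>topspace (tot E). proj E' (\<Phi> p) = proj E p) \<and>
     (\<forall>p\<in>topspace (tot E). \<forall>q\<in>topspace (tot E). proj E p = proj E q \<longrightarrow>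
         \<Phi> (badd E p q) = badd E' (\<Phi> p) (\<Phi> q)) \<and>
     (\<forall>a. \<forall>p\<in>topspace (tot E). \<Phi> (bscale E a p) = bscale E' a (\<Phi> p))"

definition induced :: "('x, 'e, 'k) bbundle \<Rightarrow> ('e \<Rightarrow> 'f) \<Rightarrow> ('x \<Rightarrow> 'e) \<Rightarrow> ('x \<Rightarrow> 'f)" where
  "induced E \<Phi> s = (\<lambda>x. if x \<in> topspace (base E) then \<Phi> (s x) else undefined)"

text \<open>The set of values \<open>\<parallel>T\<parallel> \<parallel>T\<^sup>-\<^sup>1\<parallel>\<close> over admissible renormings
  (\<open>T\<^sup>-\<^sup>1\<close> is induced by \<open>\<Phi>\<^sup>-\<^sup>1\<close>).\<close>
definition bBM_values ::
  "('x, 'e, 'k) bbundle \<Rightarrow> ('x, 'f, 'k) bbundle \<Rightarrow> real set" where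
  "bBM_values E E' =
     {opnorm E E' (induced E \<Phi>) * opnorm E' E (induced E' (inv_into (topspace (tot E)) \<Phi>)) | \<Phi>.
        renorming E E' \<Phi> \<and>
        bij_betw (induced E \<Phi>) (bsections E) (bsections E') \<and>
        bounded_op E E' (induced E \<Phi>) \<and>
        bounded_op E' E (induced E' (inv_into (topspace (tot E)) \<Phi>))}"

definition eln :: "ereal \<Rightarrow> ereal" where
  "eln c = (if c = \<infinity> then \<infinity> else if c \<le> 0 then -\<infinity> else ereal (ln (real_of_ereal c)))"

text \<open>Bounded Banach--Mazur distance; the infimum of the empty set is \<open>+\<infinity>\<close>.\<close>
definition dbBM :: "('x, 'e, 'k) bbundle \<Rightarrow> ('x, 'f, 'k) bbundle \<Rightarrow> ereal" where
  "dbBM E E' = eln (Inf (ereal ` bBM_values E E'))"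

end

(* Each fibre norm has a unique John ellipsoid (the ellipsoid of maximal volume in the unit ball); its
   Euclidean norm J satisfies |v| <= J v <= sqrt n * |v|. Replacing the norm by J fibrewise and taking
   the identity as renorming gives a Hilbert bundle at distance at most log (sqrt n), provided that J
   is continuous on the total space. For this no local sections are needed: since the projection is
   open, a John basis of a fibre can be approximated by systems of vectors in all nearby fibres, on
   which the norms are uniformly close by compactness of the coordinate sphere. Optimality of the
   John ellipsoid, expressed by a bound on Hilbert-Schmidt norms, is then stable, and this forces the
   John norms to be close. *)
theory Submission
  imports Defs "Jordan_Normal_Form.Determinant"
begin

section \<open>Matrices over coordinate sequences\<close>

text \<open>The Hilbert-Schmidt bound is the first-order form of volume maximality. If the unit ball
  of a norm contains the Euclidean ball and its image under M, it also contains the image under the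
  square root of (1 - t) I + t M M^H, where M^H is the adjoint. The determinant of that root has
  derivative (tr M M^H - n) / 2 at t = 0, so maximality gives tr M M^H \<le> n. Explicit
  approximations with an error of second order spare the matrix square root. Unlike volume, this
  condition is tested on single competitors M and is robust: if two norms agree up to a factor
  \<eta>, a competitor for one becomes a competitor for the other after division by \<eta>, so its
  bound grows only to n \<eta>^2. The factor sqrt n comes from a competitor of rank one. The
  obstacle is that John bases are chosen fibre by fibre, with no continuity between the choices. The
  comparison of two John norms therefore has an error that depends only on n and \<eta>, never on
  the bases.\<close>

definition cnorm :: "nat \<Rightarrow> (nat \<Rightarrow> 'k::real_normed_field) \<Rightarrow> real" where
  "cnorm n c = L2_set (\<lambda>i. norm (c i)) {..<n}"

text \<open>Since \<open>n\<close> is a number and not a type, coordinates are sequences of which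
  the first \<open>n\<close> entries count. The value 0 from \<open>n\<close> on makes images under
  matrices equal as functions once they agree below \<open>n\<close>.\<close>

definition mvec :: "nat \<Rightarrow> (nat \<Rightarrow> nat \<Rightarrow> 'k::real_normed_field) \<Rightarrow> (nat \<Rightarrow> 'k) \<Rightarrow> nat \<Rightarrow> 'k" where
  "mvec n A c = (\<lambda>i. if i < n then \<Sum>j<n. A i j * c j else 0)"

definition mmul ::
  "nat \<Rightarrow> (nat \<Rightarrow> nat \<Rightarrow> 'k::real_normed_field) \<Rightarrow> (nat \<Rightarrow> nat \<Rightarrow> 'k) \<Rightarrow> nat \<Rightarrow> nat \<Rightarrow> 'k" where
  "mmul n A B = (\<lambda>i j. \<Sum>k<n. A i k * B k j)"

definition hs2 :: "nat \<Rightarrow> (nat \<Rightarrow> nat \<Rightarrow> 'k::real_normed_field) \<Rightarrow> real" where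
  "hs2 n A = (\<Sum>i<n. \<Sum>j<n. (norm (A i j))\<^sup>2)"

definition is_inverse :: "nat \<Rightarrow> (nat \<Rightarrow> nat \<Rightarrow> 'k::real_normed_field) \<Rightarrow> (nat \<Rightarrow> nat \<Rightarrow> 'k) \<Rightarrow> bool" where
  "is_inverse n A B \<longleftrightarrow>
     (\<forall>i<n. \<forall>j<n. mmul n A B i j = (if i = j then 1 else 0) \<and>
                      mmul n B A i j = (if i = j then 1 else 0))"

text \<open>Matrices are plain functions elsewhere, so that sums, limits and compactness apply to
  them directly; the matrix type is entered only for determinants, adjugates and kernel
  vectors.\<close>

definition mdet :: "nat \<Rightarrow> (nat \<Rightarrow> nat \<Rightarrow> 'k::real_normed_field) \<Rightarrow> 'k" where
  "mdet n A = Determinant.det (mat n n (\<lambda>(i, j). A i j))"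

lemma cnorm_nonneg [simp]: "0 \<le> cnorm n c"
  by (simp add: cnorm_def)

lemma cnorm_cong: "(\<And>i. i < n \<Longrightarrow> c i = d i) \<Longrightarrow> cnorm n c = cnorm n d"
  by (simp add: cnorm_def cong: L2_set_cong_simp)

lemma cnorm_power2: "(cnorm n c)\<^sup>2 = (\<Sum>i<n. (norm (c i))\<^sup>2)"
  by (simp add: cnorm_def L2_set_def sum_nonneg)

lemma cnorm_eq_0_iff: "cnorm n c = 0 \<longleftrightarrow> (\<forall>i<n. c i = 0)"
  by (simp add: cnorm_def L2_set_eq_0_iff Ball_def)

lemma cnorm_scale: "cnorm n (\<lambda>i. a * c i) = norm a * cnorm n c"
  by (simp add: cnorm_def norm_mult L2_set_right_distrib)

lemma cnorm_triangle: "cnorm n (\<lambda>i. c i + d i) \<le> cnorm n c + cnorm n d"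
proof -
  have "cnorm n (\<lambda>i. c i + d i) \<le> L2_set (\<lambda>i. norm (c i) + norm (d i)) {..<n}"
    unfolding cnorm_def by (rule L2_set_mono) (auto intro: norm_triangle_ineq)
  also have "\<dots> \<le> cnorm n c + cnorm n d"
    unfolding cnorm_def by (rule L2_set_triangle_ineq)
  finally show ?thesis .
qed

lemma norm_le_cnorm: "i < n \<Longrightarrow> norm (c i) \<le> cnorm n c"
  unfolding cnorm_def by (rule member_le_L2_set) auto

lemma norm_sum_mult_le_cnorm: "norm (\<Sum>i<n. c i * d i) \<le> cnorm n c * cnorm n d"
proof -
  have "norm (\<Sum>i<n. c i * d i) \<le> (\<Sum>i<n. \<bar>norm (c i)\<bar> * \<bar>norm (d i)\<bar>)"
    by (rule order_trans[OF norm_sum]) (simp add: norm_mult)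
  also have "\<dots> \<le> cnorm n c * cnorm n d"
    unfolding cnorm_def by (rule L2_set_mult_ineq)
  finally show ?thesis .
qed

lemma hs2_nonneg [simp]: "0 \<le> hs2 n A"
  by (simp add: hs2_def sum_nonneg)

lemma hs2_scale: "hs2 n (\<lambda>i j. a * A i j) = (norm a)\<^sup>2 * hs2 n A"
  by (simp add: hs2_def norm_mult power_mult_distrib sum_distrib_left)

text \<open>Cauchy-Schwarz on each row: the Hilbert-Schmidt norm dominates the operator
  norm.\<close>

lemma cnorm_mvec_le: "cnorm n (mvec n A c) \<le> sqrt (hs2 n A) * cnorm n c"
proof -
  have "(cnorm n (mvec n A c))\<^sup>2 \<le> (\<Sum>i<n. (cnorm n (A i))\<^sup>2 * (cnorm n c)\<^sup>2)"
    unfolding cnorm_power2[of n "mvec n A c"]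
  proof (rule sum_mono)
    fix i assume "i \<in> {..<n}"
    then have "norm (mvec n A c i) \<le> cnorm n (A i) * cnorm n c"
      by (simp add: mvec_def norm_sum_mult_le_cnorm)
    from power_mono[OF this, of 2]
    show "(norm (mvec n A c i))\<^sup>2 \<le> (cnorm n (A i))\<^sup>2 * (cnorm n c)\<^sup>2"
      by (simp add: power_mult_distrib)
  qed
  also have "\<dots> = (sqrt (hs2 n A) * cnorm n c)\<^sup>2"
    by (simp add: power_mult_distrib hs2_def cnorm_power2[of n "A _"] sum_distrib_right sum_nonneg)
  finally show ?thesis
    by (rule power2_le_imp_le) simp
qed

lemma mvec_cong:
  "(\<And>i j. i < n \<Longrightarrow> j < n \<Longrightarrow> A i j = B i j) \<Longrightarrow> (\<And>i. i < n \<Longrightarrow> c i = d i) \<Longrightarrow> mvec n A c = mvec n B d"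
  by (auto simp: mvec_def fun_eq_iff intro!: sum.cong)

lemma mvec_mmul: "mvec n (mmul n A B) c = mvec n A (mvec n B c)"
proof
  fix i
  show "mvec n (mmul n A B) c i = mvec n A (mvec n B c) i"
  proof (cases "i < n")
    case True
    have "(\<Sum>j<n. (\<Sum>k<n. A i k * B k j) * c j) = (\<Sum>j<n. \<Sum>k<n. A i k * (B k j * c j))"
      by (simp add: sum_distrib_right mult.assoc)
    also have "\<dots> = (\<Sum>k<n. \<Sum>j<n. A i k * (B k j * c j))"
      by (rule sum.swap)
    finally show ?thesis
      using True by (simp add: mvec_def mmul_def sum_distrib_left)
  qed (simp add: mvec_def)
qed

lemma mvec_unit:
  "(\<And>i j. i < n \<Longrightarrow> j < n \<Longrightarrow> A i j = (if i = j then 1 else 0)) \<Longrightarrow> i < n \<Longrightarrow> mvec n A c i = c i"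
  by (simp add: mvec_def if_distrib[of "\<lambda>x. x * _"] sum.delta cong: if_cong)

lemma mvec_inverse: "is_inverse n A B \<Longrightarrow> i < n \<Longrightarrow> mvec n A (mvec n B c) i = c i"
  by (subst mvec_mmul[symmetric]) (auto simp: is_inverse_def intro!: mvec_unit)

lemma is_inverse_sym: "is_inverse n A B \<Longrightarrow> is_inverse n B A"
  by (auto simp: is_inverse_def)

lemma mvec_add: "mvec n A (\<lambda>i. c i + d i) = (\<lambda>i. mvec n A c i + mvec n A d i)"
  by (auto simp: mvec_def fun_eq_iff ring_distribs sum.distrib)

lemma mvec_scale: "mvec n A (\<lambda>i. a * c i) = (\<lambda>i. a * mvec n A c i)"
  by (auto simp: mvec_def fun_eq_iff sum_distrib_left algebra_simps)

lemma mvec_scale_matrix: "mvec n (\<lambda>i j. a * A i j) c = (\<lambda>i. a * mvec n A c i)"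
  by (auto simp: mvec_def fun_eq_iff sum_distrib_left algebra_simps)

lemma mvec_diff_matrix: "mvec n (\<lambda>i j. A i j - B i j) c = (\<lambda>i. mvec n A c i - mvec n B c i)"
  by (auto simp: mvec_def fun_eq_iff algebra_simps sum_subtractf)

section \<open>Determinants and invertibility of n by n matrices\<close>

lemma mdet_mmul: "mdet n (mmul n A B) = mdet n A * mdet n B"
proof -
  have "mat n n (\<lambda>(i, j). mmul n A B i j) = mat n n (\<lambda>(i, j). A i j) * mat n n (\<lambda>(i, j). B i j)"
    by (rule eq_matI) (auto simp: mmul_def scalar_prod_def atLeast0LessThan)
  then show ?thesis
    by (simp add: mdet_def det_mult[of _ n])
qed

lemma mdet_unit: "mdet n (\<lambda>i j. if i = j then 1 else 0) = (1 :: 'k::real_normed_field)"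
proof -
  have "mat n n (\<lambda>(i, j). if i = j then 1 else 0) = (1\<^sub>m n :: 'k mat)"
    by (rule eq_matI) auto
  then show ?thesis
    by (simp add: mdet_def)
qed

lemma mdet_cong:
  "(\<And>i j. i < n \<Longrightarrow> j < n \<Longrightarrow> A i j = B i j) \<Longrightarrow> mdet n A = mdet n B"
  unfolding mdet_def by (rule arg_cong[where f = Determinant.det]) (auto intro!: eq_matI)

lemma mdet_Leibniz:
  "mdet n A = (\<Sum>p | p permutes {..<n}. signof p * (\<Prod>i<n. A i (p i)))"
proof -
  have *: "(\<Prod>i = 0..<n. mat n n (\<lambda>(i, j). A i j) $$ (i, p i)) = (\<Prod>i<n. A i (p i))"
    if "p permutes {..<n}" for p
    using that by (auto simp: atLeast0LessThan permutes_in_image intro!: prod.cong)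
  show ?thesis
    unfolding mdet_def by (subst det_def'[of _ n]) (auto simp: atLeast0LessThan[symmetric] intro!: sum.cong *[unfolded atLeast0LessThan[symmetric]])
qed

lemma mdet_nonzero_inverse:
  assumes "mdet n A \<noteq> 0"
  obtains B where "is_inverse n A B"
proof -
  define M where "M = mat n n (\<lambda>(i, j). A i j)"
  define B where "B = (\<lambda>i j. inverse (mdet n A) * adj_mat M $$ (i, j))"
  have M: "M \<in> carrier_mat n n" by (simp add: M_def)
  have adj: "adj_mat M \<in> carrier_mat n n" "M * adj_mat M = Determinant.det M \<cdot>\<^sub>m 1\<^sub>m n"
    "adj_mat M * M = Determinant.det M \<cdot>\<^sub>m 1\<^sub>m n"
    using adj_mat[OF M] by auto
  have d: "Determinant.det M = mdet n A" by (simp add: M_def mdet_def)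
  have "mmul n A B i j = (if i = j then 1 else 0) \<and> mmul n B A i j = (if i = j then 1 else 0)"
    if ij: "i < n" "j < n" for i j
  proof -
    have "(M * adj_mat M) $$ (i, j) = (\<Sum>k<n. A i k * adj_mat M $$ (k, j))"
      using ij adj(1) by (auto simp: scalar_prod_def atLeast0LessThan M_def intro!: sum.cong)
    then have "(\<Sum>k<n. A i k * adj_mat M $$ (k, j)) = mdet n A * (if i = j then 1 else 0)"
      using ij unfolding adj(2) d by simp
    then have 1: "mmul n A B i j = (if i = j then 1 else 0)"
      using assms by (simp add: mmul_def B_def mult.left_commute[of _ "inverse _"] flip: sum_distrib_left)
    have "(adj_mat M * M) $$ (i, j) = (\<Sum>k<n. adj_mat M $$ (i, k) * A k j)"
      using ij adj(1) by (auto simp: scalar_prod_def atLeast0LessThan M_def intro!: sum.cong)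
    then have "(\<Sum>k<n. adj_mat M $$ (i, k) * A k j) = mdet n A * (if i = j then 1 else 0)"
      using ij unfolding adj(3) d by simp
    then have 2: "mmul n B A i j = (if i = j then 1 else 0)"
      using assms by (simp add: mmul_def B_def mult.assoc flip: sum_distrib_left)
    show ?thesis using 1 2 by blast
  qed
  then have "is_inverse n A B" by (auto simp: is_inverse_def)
  then show ?thesis by (rule that)
qed

text \<open>A matrix of determinant 0 has a nonzero kernel vector, so injectivity makes the
  determinant nonzero and the adjugate supplies the inverse.\<close>

lemma injective_imp_inverse:
  assumes inj: "\<And>c. (\<And>i. i < n \<Longrightarrow> mvec n A c i = 0) \<Longrightarrow> (\<And>i. i < n \<Longrightarrow> c i = 0)"
  obtains B where "is_inverse n A B"
proof -
  let ?M = "mat n n (\<lambda>(i, j). A i j)"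
  have "mdet n A \<noteq> 0"
  proof
    assume "mdet n A = 0"
    then obtain v where v: "v \<in> carrier_vec n" "v \<noteq> 0\<^sub>v n" "?M *\<^sub>v v = 0\<^sub>v n"
      unfolding mdet_def using det_0_iff_vec_prod_zero_field[of ?M n] by auto
    have "mvec n A (\<lambda>j. v $ j) i = 0" if "i < n" for i
    proof -
      have "mvec n A (\<lambda>j. v $ j) i = (?M *\<^sub>v v) $ i"
        using that v(1) by (auto simp: mvec_def scalar_prod_def atLeast0LessThan intro!: sum.cong)
      then show ?thesis using that v(3) by simp
    qed
    then have "v = 0\<^sub>v n"
      using inj[of "\<lambda>j. v $ j"] v(1) by (intro eq_vecI) auto
    then show False using v(2) by blast
  qed
  then show ?thesis using mdet_nonzero_inverse that by blast
qed

text \<open>Only the identity permutation contributes: any other one moves at least two indices, so the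
  corresponding product of entries vanishes to second order.\<close>
lemma has_derivative_mdet_unit:
  fixes H :: "real \<Rightarrow> nat \<Rightarrow> nat \<Rightarrow> 'k::real_normed_field"
  assumes unit: "\<And>i j. i < n \<Longrightarrow> j < n \<Longrightarrow> H 0 i j = (if i = j then 1 else 0)"
    and der: "\<And>i j. i < n \<Longrightarrow> j < n \<Longrightarrow> ((\<lambda>t. H t i j) has_vector_derivative D i j) (at 0)"
  shows "((\<lambda>t. mdet n (H t)) has_vector_derivative (\<Sum>i<n. D i i)) (at 0)"
proof -
  define g where "g p = signof p * (\<Sum>i<n. D i (p i) * (\<Prod>j\<in>{..<n}-{i}. H 0 j (p j)))" for p
  have *: "((\<lambda>t. signof p * (\<Prod>i<n. H t i (p i))) has_vector_derivative g p) (at 0)"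
    if p: "p permutes {..<n}" for p
  proof -
    have pn: "p i < n" if "i < n" for i using that p permutes_in_image by fastforce
    have "((\<lambda>t. \<Prod>i<n. H t i (p i)) has_derivative
        (\<lambda>y. \<Sum>i<n. (y *\<^sub>R D i (p i)) * (\<Prod>j\<in>{..<n}-{i}. H 0 j (p j)))) (at 0)"
      by (rule has_derivative_prod) (use der pn in \<open>auto simp: has_vector_derivative_def\<close>)
    then have "((\<lambda>t. \<Prod>i<n. H t i (p i)) has_vector_derivative
        (\<Sum>i<n. D i (p i) * (\<Prod>j\<in>{..<n}-{i}. H 0 j (p j)))) (at 0)"
      by (simp add: has_vector_derivative_def scaleR_sum_right)
    then show ?thesis
      unfolding g_def by (rule has_vector_derivative_mult_right)
  qed
  have gid: "g id = (\<Sum>i<n. D i i)"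
    unfolding g_def by (auto simp: unit intro!: sum.cong prod.neutral)
  have g0: "g p = 0" if p: "p permutes {..<n}" and "p \<noteq> id" for p
  proof -
    obtain a where a: "p a \<noteq> a" using \<open>p \<noteq> id\<close> by (metis eq_id_iff)
    have an: "a < n" using a p by (metis lessThan_iff permutes_not_in)
    have pn: "p i < n" if "i < n" for i using that p permutes_in_image by fastforce
    have inj: "p (p a) \<noteq> p a" using a p by (metis permutes_inj injD)
    have "(\<Prod>j\<in>{..<n}-{i}. H 0 j (p j)) = 0" for i
    proof (cases "i = a")
      case True
      then have "p a \<in> {..<n} - {i}" "H 0 (p a) (p (p a)) = 0"
        using a an pn inj by (auto simp: unit)
      then show ?thesis by (meson finite_Diff finite_lessThan prod_zero)
    next
      case False
      then have "a \<in> {..<n} - {i}" "H 0 a (p a) = 0"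
        using a an pn by (auto simp: unit)
      then show ?thesis by (meson finite_Diff finite_lessThan prod_zero)
    qed
    then show ?thesis by (simp only: g_def mult_zero_right sum.neutral_const)
  qed
  have "((\<lambda>t. \<Sum>p | p permutes {..<n}. signof p * (\<Prod>i<n. H t i (p i))) has_vector_derivative
      (\<Sum>p | p permutes {..<n}. g p)) (at 0)"
    by (rule has_vector_derivative_sum) (use * in auto)
  moreover have "(\<Sum>p | p permutes {..<n}. g p) = (\<Sum>p\<in>{id}. g p)"
    by (rule sum.mono_neutral_right) (auto simp: finite_permutations permutes_id g0)
  ultimately show ?thesis
    by (simp add: mdet_Leibniz gid)
qed

lemma continuous_on_mdet:
  "continuous_on UNIV (mdet n :: (nat \<Rightarrow> nat \<Rightarrow> 'k::real_normed_field) \<Rightarrow> 'k)"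
proof -
  have "continuous_on UNIV (\<lambda>A :: nat \<Rightarrow> nat \<Rightarrow> 'k. A i j)" for i j
    by (rule continuous_on_product_then_coordinatewise) simp
  then show ?thesis
    unfolding mdet_Leibniz[abs_def] by (intro continuous_intros)
qed

section \<open>Norms on coordinate spaces\<close>

text \<open>Instantiated by the identity on the reals and by \<open>cnj\<close> on the complex
  numbers, so that both fields share one proof. \<open>mult_cj\<close> ties conjugation to the norm;
  \<open>heine_borel\<close> provides compact balls of scalars.\<close>

locale conj_field =
  fixes cj :: "'k::{real_normed_field, heine_borel} \<Rightarrow> 'k"
  assumes cj_add: "cj (a + b) = cj a + cj b"
    and cj_mult: "cj (a * b) = cj a * cj b"
    and cj_cj [simp]: "cj (cj a) = a"
    and cj_of_real [simp]: "cj (of_real r) = of_real r"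
    and mult_cj: "a * cj a = of_real ((norm a)\<^sup>2)"
begin

lemma cj_0 [simp]: "cj 0 = 0"
  using cj_of_real[of 0] by simp

lemma cj_diff: "cj (a - b) = cj a - cj b"
  using cj_add[of "a - b" b] by simp

lemma cj_sum: "cj (sum f S) = (\<Sum>i\<in>S. cj (f i))"
  by (induction S rule: infinite_finite_induct) (auto simp: cj_add)

lemma norm_cj [simp]: "norm (cj a) = norm a"
proof (cases "a = 0")
  case False
  have "norm a * norm (cj a) = (norm a)\<^sup>2"
    by (simp add: mult_cj norm_power flip: norm_mult)
  then show ?thesis using False by (simp add: power2_eq_square)
qed simp

definition ip :: "nat \<Rightarrow> (nat \<Rightarrow> 'k) \<Rightarrow> (nat \<Rightarrow> 'k) \<Rightarrow> 'k" where
  "ip n c d = (\<Sum>i<n. c i * cj (d i))"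

definition adj :: "(nat \<Rightarrow> nat \<Rightarrow> 'k) \<Rightarrow> nat \<Rightarrow> nat \<Rightarrow> 'k" where
  "adj A = (\<lambda>i j. cj (A j i))"

lemma ip_self: "ip n c c = of_real ((cnorm n c)\<^sup>2)"
  by (simp add: ip_def mult_cj cnorm_power2)

lemma cj_ip: "cj (ip n c d) = ip n d c"
  by (simp add: ip_def cj_sum cj_mult mult.commute)

lemma norm_ip_le: "norm (ip n c d) \<le> cnorm n c * cnorm n d"
  using norm_sum_mult_le_cnorm[where n = n and c = c and d = "\<lambda>i. cj (d i)"] by (simp add: ip_def cnorm_def)

lemma ip_diff_left: "ip n (\<lambda>i. c i - d i) e = ip n c e - ip n d e"
  by (simp add: ip_def algebra_simps sum_subtractf)

lemma ip_diff_right: "ip n e (\<lambda>i. c i - d i) = ip n e c - ip n e d"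
  by (simp add: ip_def algebra_simps cj_diff sum_subtractf)

lemma ip_scale_left: "ip n (\<lambda>i. a * c i) d = a * ip n c d"
  by (simp add: ip_def sum_distrib_left mult.assoc)

lemma ip_scale_right: "ip n c (\<lambda>i. a * d i) = cj a * ip n c d"
  by (simp add: ip_def cj_mult sum_distrib_left mult.left_commute)

lemma ip_mvec: "ip n (mvec n A c) d = ip n c (mvec n (adj A) d)"
proof -
  have "ip n (mvec n A c) d = (\<Sum>i<n. \<Sum>j<n. A i j * c j * cj (d i))"
    by (simp add: ip_def mvec_def sum_distrib_right)
  also have "\<dots> = (\<Sum>j<n. \<Sum>i<n. A i j * c j * cj (d i))"
    by (rule sum.swap)
  also have "\<dots> = ip n c (mvec n (adj A) d)"
    by (simp add: ip_def mvec_def adj_def cj_sum cj_mult sum_distrib_left algebra_simps)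
  finally show ?thesis .
qed

text \<open>Turns the trace that arises as derivative of the determinant into a Hilbert-Schmidt
  norm.\<close>

lemma trace_mmul_adj: "(\<Sum>i<n. mmul n M (adj M) i i) = of_real (hs2 n M)"
  by (simp add: mmul_def adj_def mult_cj hs2_def)

text \<open>The inner product of P c with c is the squared length of M^H c. The first-order loss is
  thus exactly \<open>t\<close> times this square, which \<open>perturb_le_cnorm\<close> adds back,
  leaving an error of order t^2.\<close>

lemma cnorm_perturb:
  fixes M n t
  defines "P \<equiv> mmul n M (adj M)"
  shows "(cnorm n (\<lambda>i. c i - of_real (t / 2) * mvec n P c i))\<^sup>2 =
         (cnorm n c)\<^sup>2 - t * (cnorm n (mvec n (adj M) c))\<^sup>2 + t\<^sup>2 / 4 * (cnorm n (mvec n P c))\<^sup>2"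
proof -
  have 1: "ip n (mvec n P c) c = of_real ((cnorm n (mvec n (adj M) c))\<^sup>2)"
    by (simp add: P_def mvec_mmul ip_mvec[of n M] ip_self)
  have 2: "ip n c (mvec n P c) = of_real ((cnorm n (mvec n (adj M) c))\<^sup>2)"
    using arg_cong[OF 1, of cj] by (simp only: cj_ip cj_of_real)
  have "of_real ((cnorm n (\<lambda>i. c i - of_real (t / 2) * mvec n P c i))\<^sup>2) =
     (of_real ((cnorm n c)\<^sup>2 - t * (cnorm n (mvec n (adj M) c))\<^sup>2 +
        t\<^sup>2 / 4 * (cnorm n (mvec n P c))\<^sup>2) :: 'k)"
    unfolding ip_self[symmetric] ip_diff_left ip_diff_right ip_scale_left ip_scale_right cj_of_real 1 2
    unfolding ip_self of_real_mult[symmetric] of_real_diff[symmetric] of_real_eq_iff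
    by (simp add: field_simps power2_eq_square)
  then show ?thesis
    by (simp only: of_real_eq_iff)
qed

end

text \<open>Definiteness is left out because vectors picked in a nearby fibre are at first not known
  to be independent. \<open>cong\<close> says that only the first \<open>n\<close> coordinates
  matter.\<close>

locale coord_seminorm =
  fixes n :: nat and \<nu> :: "(nat \<Rightarrow> 'k::{real_normed_field, heine_borel}) \<Rightarrow> real"
  assumes triangle: "\<nu> (\<lambda>i. c i + d i) \<le> \<nu> c + \<nu> d"
    and scale: "\<nu> (\<lambda>i. a * c i) = norm a * \<nu> c"
    and cong: "(\<And>i. i < n \<Longrightarrow> c i = d i) \<Longrightarrow> \<nu> c = \<nu> d"
begin

lemma zero [simp]: "\<nu> (\<lambda>i. 0) = 0"
  using scale[of 0 "\<lambda>i. 0"] by simp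

lemma nonneg [simp]: "0 \<le> \<nu> c"
proof -
  have "\<nu> (\<lambda>i. c i + (- 1) * c i) \<le> \<nu> c + \<nu> (\<lambda>i. (- 1) * c i)"
    by (rule triangle)
  then show ?thesis unfolding scale by simp
qed

lemma sum_le: "\<nu> (\<lambda>i. \<Sum>j\<in>S. f j i) \<le> (\<Sum>j\<in>S. \<nu> (f j))"
  by (induction S rule: infinite_finite_induct) (auto intro: order_trans[OF triangle])

lemma diff_le: "\<bar>\<nu> c - \<nu> d\<bar> \<le> \<nu> (\<lambda>i. c i - d i)"
proof -
  have "\<nu> c \<le> \<nu> (\<lambda>i. c i - d i) + \<nu> d"
    using triangle[of "\<lambda>i. c i - d i" d] by simp
  moreover have "\<nu> d \<le> \<nu> (\<lambda>i. (- 1) * (c i - d i)) + \<nu> c"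
    using triangle[of "\<lambda>i. (- 1) * (c i - d i)" c] by simp
  ultimately show ?thesis unfolding scale by simp
qed

lemma le_cnorm: obtains K where "K > 0" "\<And>c. \<nu> c \<le> K * cnorm n c"
proof
  define u :: "nat \<Rightarrow> nat \<Rightarrow> 'k" where "u j i = (if i = j then 1 else 0)" for i j
  show "1 + (\<Sum>j<n. \<nu> (u j)) > 0"
    by (smt (verit) nonneg sum_nonneg)
  fix c
  have "\<nu> c = \<nu> (\<lambda>i. \<Sum>j<n. c j * u j i)"
    by (rule cong) (simp add: u_def if_distrib[of "\<lambda>x. _ * x"] cong: if_cong)
  also have "\<dots> \<le> (\<Sum>j<n. norm (c j) * \<nu> (u j))"
    using sum_le[of "\<lambda>j i. c j * u j i"] by (simp add: scale)
  also have "\<dots> \<le> (\<Sum>j<n. cnorm n c * \<nu> (u j))"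
    by (intro sum_mono mult_right_mono) (auto intro: norm_le_cnorm)
  also have "\<dots> \<le> (1 + (\<Sum>j<n. \<nu> (u j))) * cnorm n c"
    by (simp add: sum_distrib_left[symmetric] algebra_simps)
  finally show "\<nu> c \<le> (1 + (\<Sum>j<n. \<nu> (u j))) * cnorm n c" .
qed

lemma mvec: "coord_seminorm n (\<lambda>c. \<nu> (mvec n A c))"
proof
  show "\<nu> (mvec n A c) = \<nu> (mvec n A d)" if "\<And>i. i < n \<Longrightarrow> c i = d i" for c d
    using mvec_cong[of n A A c d] that by simp
qed (auto simp: mvec_add mvec_scale triangle scale)

text \<open>Continuity refers to the product topology on sequences: \<nu> is Lipschitz for
  \<open>cnorm\<close>, which involves only finitely many coordinates.\<close>

lemma continuous: "continuous_on UNIV \<nu>"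
proof -
  obtain K where K: "K > 0" "\<And>c. \<nu> c \<le> K * cnorm n c"
    using le_cnorm by blast
  have "\<nu> \<midarrow>d\<rightarrow> \<nu> d" for d
  proof (subst LIM_zero_iff[symmetric], rule Lim_null_comparison)
    show "\<forall>\<^sub>F c in at d. norm (\<nu> c - \<nu> d) \<le> K * cnorm n (\<lambda>i. c i - d i)"
      using diff_le K(2) by (auto intro!: always_eventually order_trans[OF diff_le])
    have "continuous_on UNIV (\<lambda>c :: nat \<Rightarrow> 'k. K * cnorm n (\<lambda>i. c i - d i))"
      unfolding cnorm_def L2_set_def by (intro continuous_intros) auto
    then have "((\<lambda>c. K * cnorm n (\<lambda>i. c i - d i)) \<longlongrightarrow> K * cnorm n (\<lambda>i. d i - d i)) (at d)"
      unfolding continuous_on_def by blast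
    moreover have "cnorm n (\<lambda>i. d i - d i) = 0"
      by (simp add: cnorm_eq_0_iff)
    ultimately show "((\<lambda>c. K * cnorm n (\<lambda>i. c i - d i)) \<longlongrightarrow> 0) (at d)"
      by simp
  qed
  then show ?thesis by (auto simp: continuous_on_def)
qed

end

section \<open>Compactness of the coordinate sphere and equivalence of norms\<close>

lemma compact_box:
  fixes S :: "'i \<Rightarrow> 'a::topological_space set"
  assumes "\<And>i. compact (S i)"
  shows "compact {f. \<forall>i. f i \<in> S i}"
proof -
  have "compactin (product_topology (\<lambda>i. euclidean) UNIV) (PiE UNIV S)"
    using assms by (subst compactin_PiE) auto
  moreover have "PiE UNIV S = {f. \<forall>i. f i \<in> S i}" by auto
  ultimately show ?thesis by (simp add: euclidean_product_topology)
qed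

text \<open>Fixing the coordinates from \<open>n\<close> on is what makes this set compact in the
  space of all sequences.\<close>

definition csphere :: "nat \<Rightarrow> (nat \<Rightarrow> 'k::real_normed_field) set" where
  "csphere n = {c. cnorm n c = 1 \<and> (\<forall>i\<ge>n. c i = 0)}"

lemma continuous_on_cnorm: "continuous_on UNIV (cnorm n)"
  unfolding cnorm_def[abs_def] L2_set_def by (intro continuous_intros) auto

lemma compact_csphere: "compact (csphere n :: (nat \<Rightarrow> 'k::{real_normed_field, heine_borel}) set)"
proof -
  define S where "S i = (if i < n then cball 0 1 else {0 :: 'k})" for i
  have "compact {f. \<forall>i. f i \<in> S i}"
    by (rule compact_box) (simp add: S_def)
  moreover have "closed {c :: nat \<Rightarrow> 'k. cnorm n c = 1}"
    by (rule closed_Collect_eq) (auto intro: continuous_on_cnorm)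
  moreover have "(csphere n :: (nat \<Rightarrow> 'k) set) = {f. \<forall>i. f i \<in> S i} \<inter> {c. cnorm n c = 1}"
  proof (intro equalityI subsetI)
    fix c :: "nat \<Rightarrow> 'k" assume c: "c \<in> csphere n"
    then have "norm (c i) \<le> 1" if "i < n" for i
      using norm_le_cnorm[OF that, of c] by (simp add: csphere_def)
    then show "c \<in> {f. \<forall>i. f i \<in> S i} \<inter> {c. cnorm n c = 1}"
      using c by (simp add: S_def csphere_def)
  next
    fix c :: "nat \<Rightarrow> 'k" assume "c \<in> {f. \<forall>i. f i \<in> S i} \<inter> {c. cnorm n c = 1}"
    then have c: "\<And>i. c i \<in> S i" "cnorm n c = 1" by auto
    have "c i = 0" if "i \<ge> n" for i using c(1)[of i] that by (simp add: S_def)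
    then show "c \<in> csphere n" using c(2) by (simp add: csphere_def)
  qed
  ultimately show ?thesis by (auto intro: compact_Int_closed)
qed

lemma csphere_normalize:
  assumes "cnorm n c \<noteq> 0"
  shows "(\<lambda>i. if i < n then of_real (inverse (cnorm n c)) * c i else 0) \<in> csphere n"
proof -
  let ?d = "\<lambda>i. if i < n then of_real (inverse (cnorm n c)) * c i else 0"
  have "cnorm n ?d = cnorm n (\<lambda>i. of_real (inverse (cnorm n c)) * c i)"
    by (rule cnorm_cong) simp
  then show ?thesis
    using assms by (simp add: csphere_def cnorm_scale norm_inverse)
qed

locale coord_norm = coord_seminorm +
  assumes eq_0: "\<nu> c = 0 \<Longrightarrow> i < n \<Longrightarrow> c i = 0"
begin

lemma cnorm_le: obtains k where "k > 0" "\<And>c. k * cnorm n c \<le> \<nu> c"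
\<comment> \<open>The minimum of \<nu> on the compact sphere serves as \<open>k\<close>. For n = 0
  the sphere is empty and any positive constant works.\<close>
proof (cases "(csphere n :: (nat \<Rightarrow> 'a) set) = {}")
  case True
  then have "cnorm n c = 0" for c :: "nat \<Rightarrow> 'a" using csphere_normalize[of n c] by auto
  then show ?thesis using that[of 1] by simp
next
  case False
  then obtain e where e: "e \<in> csphere n" and min: "\<And>c. c \<in> csphere n \<Longrightarrow> \<nu> e \<le> \<nu> c"
    using continuous_attains_inf[OF compact_csphere False, of \<nu>] continuous
    by (meson continuous_on_subset subset_UNIV)
  have "\<nu> e \<noteq> 0"
    using e eq_0[of e] cnorm_eq_0_iff[of n e] by (auto simp: csphere_def)
  then have pos: "\<nu> e > 0" using nonneg[of e] by linarith
  have "\<nu> e * cnorm n c \<le> \<nu> c" for c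
  proof (cases "cnorm n c = 0")
    case nz: False
    let ?r = "of_real (inverse (cnorm n c)) :: 'a"
    have "\<nu> e \<le> \<nu> (\<lambda>i. if i < n then ?r * c i else 0)"
      by (rule min[OF csphere_normalize[OF nz]])
    also have "\<dots> = \<nu> (\<lambda>i. ?r * c i)"
      by (rule cong) simp
    also have "\<dots> = inverse (cnorm n c) * \<nu> c"
      by (simp add: scale norm_inverse)
    finally show ?thesis using nz by (simp add: field_simps less_le)
  qed simp
  then show ?thesis using that pos by blast
qed

end

section \<open>The John ellipsoid\<close>

text \<open>The Euclidean unit ball is the ellipsoid of maximal volume in the unit ball of \<open>\<nu>\<close>, stated
  through the first-order optimality condition \<open>tr (M M\<^sup>*) \<le> n\<close> for every ellipsoid
  \<open>M (ball)\<close> inside the unit ball of \<open>\<nu>\<close>.\<close>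
definition john :: "nat \<Rightarrow> ((nat \<Rightarrow> 'k::real_normed_field) \<Rightarrow> real) \<Rightarrow> bool" where
  "john n \<nu> \<longleftrightarrow> (\<forall>c. \<nu> c \<le> cnorm n c) \<and>
     (\<forall>M. (\<forall>c. \<nu> (mvec n M c) \<le> cnorm n c) \<longrightarrow> hs2 n M \<le> real n)"

context conj_field
begin

text \<open>A second-order approximation of the square root of \<open>(1 - t) + t M M\<^sup>*\<close>, shrunk slightly.\<close>
definition perturb :: "nat \<Rightarrow> (nat \<Rightarrow> nat \<Rightarrow> 'k) \<Rightarrow> real \<Rightarrow> nat \<Rightarrow> nat \<Rightarrow> 'k" where
  "perturb n M t = (\<lambda>i j. of_real (1 - t\<^sup>2 * hs2 n (mmul n M (adj M)) / 4) *
     (of_real (sqrt (1 - t)) * ((if i = j then 1 else 0) - of_real (t / 2) * mmul n M (adj M) i j) +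
      of_real t * mmul n M (adj M) i j))"

text \<open>To first order \<open>perturb n M t\<close> is I + (t / 2) (M M^H - I), and the
  derivative of the determinant at the identity is the trace. The sign of hs2 n M - n therefore
  decides whether the volume grows.\<close>

lemma has_vector_derivative_mdet_perturb:
  "((\<lambda>t. mdet n (perturb n M t)) has_vector_derivative of_real ((hs2 n M - real n) / 2)) (at 0)"
proof -
  let ?P = "mmul n M (adj M)"
  let ?D = "\<lambda>i j. of_real (1 / 2) * (?P i j - (if i = j then 1 else 0))"
  have "((\<lambda>t. perturb n M t i j) has_vector_derivative ?D i j) (at 0)" for i j
    unfolding perturb_def
    by (rule derivative_eq_intros refl | simp)+
  moreover have "perturb n M 0 i j = (if i = j then 1 else 0)" for i j
    by (simp add: perturb_def)
  ultimately have "((\<lambda>t. mdet n (perturb n M t)) has_vector_derivative (\<Sum>i<n. ?D i i)) (at 0)"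
    by (intro has_derivative_mdet_unit)
  also have "(\<Sum>i<n. ?D i i) = of_real (1 / 2) * ((\<Sum>i<n. ?P i i) - of_nat n)"
    by (simp add: sum_subtractf flip: sum_distrib_left sum_divide_distrib)
  also have "\<dots> = of_real ((hs2 n M - real n) / 2)"
    unfolding trace_mmul_adj by simp
  finally show ?thesis .
qed

lemma exists_mdet_perturb_gt_1:
  assumes "real n < hs2 n M" "\<delta> > 0"
  obtains t where "0 < t" "t < \<delta>" "norm (mdet n (perturb n M t)) > 1"
proof -
  define d where "d = (hs2 n M - real n) / 2"
  have d: "d > 0" using assms(1) by (simp add: d_def)
  have at0: "mdet n (perturb n M 0) = 1"
    by (rule trans[OF mdet_cong mdet_unit]) (simp add: perturb_def)
  have "\<forall>e>0. \<exists>r>0. \<forall>y. norm (y - 0) < r \<longrightarrow>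
      norm (mdet n (perturb n M y) - mdet n (perturb n M 0) - (y - 0) *\<^sub>R of_real d) \<le> e * norm (y - 0)"
    using has_vector_derivative_mdet_perturb[of n M]
    unfolding has_vector_derivative_def has_derivative_at_alt d_def by blast
  \<comment> \<open>Allowing the remainder half of the linear gain \<open>t * d\<close> still leaves
    a determinant of modulus at least 1 + t * d / 2.\<close>
  moreover have "d / 2 > 0" using d by simp
  ultimately obtain r where r: "r > 0" and
    le: "\<And>y. \<bar>y\<bar> < r \<Longrightarrow> norm (mdet n (perturb n M y) - 1 - y *\<^sub>R of_real d) \<le> d / 2 * \<bar>y\<bar>"
    unfolding at0 by (metis diff_zero real_norm_def)
  define t where "t = min (r / 2) (\<delta> / 2)"
  have t: "0 < t" "t < r" "t < \<delta>" using r assms(2) by (auto simp: t_def)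
  have "norm (of_real (1 + t * d) :: 'k) = 1 + t * d"
    using t d by (simp only: norm_of_real) (simp add: add_nonneg_nonneg)
  moreover have "of_real (1 + t * d) =
      mdet n (perturb n M t) - (mdet n (perturb n M t) - 1 - t *\<^sub>R of_real d)"
    by (simp add: scaleR_conv_of_real)
  ultimately have "1 + t * d \<le> norm (mdet n (perturb n M t)) + d / 2 * t"
    using norm_triangle_ineq4[of "mdet n (perturb n M t)" "mdet n (perturb n M t) - 1 - t *\<^sub>R of_real d"]
      le[of t] t by simp
  moreover have "t * d > 0" using t d by simp
  ultimately have "norm (mdet n (perturb n M t)) > 1"
    by (simp add: algebra_simps)
  then show ?thesis using that t by blast
qed

text \<open>Before shrinking, the image of \<open>c\<close> is sqrt (1 - t) a + t M (M^H c) with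
  \<open>a\<close> close to \<open>c\<close>. The bounds for the ball apply to \<open>a\<close> and
  those for \<open>M\<close> to M^H c; Cauchy-Schwarz with weights 1 - t and t combines them. The
  result exceeds the squared length of \<open>c\<close> only by a factor 1 + u with u of order
  t^2.\<close>

lemma perturb_le_cnorm:
  assumes "coord_seminorm n \<nu>"
    and unit: "\<And>c. \<nu> c \<le> cnorm n c"
    and M: "\<And>c. \<nu> (mvec n M c) \<le> cnorm n c"
    and t: "0 \<le> t" "t \<le> 1" "t\<^sup>2 * hs2 n (mmul n M (adj M)) / 4 \<le> 1"
  shows "\<nu> (mvec n (perturb n M t) c) \<le> cnorm n c"
proof -
  interpret coord_seminorm n \<nu> by fact
  let ?P = "mmul n M (adj M)"
  define u where "u = t\<^sup>2 * hs2 n ?P / 4"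
  define a where "a = (\<lambda>i. c i - of_real (t / 2) * mvec n ?P c i)"
  define x where "x = cnorm n a"
  define z where "z = cnorm n (mvec n (adj M) c)"
  define r where "r = sqrt (1 - t)"
  have u: "0 \<le> u" "u \<le> 1" using t by (simp_all add: u_def)
  have r: "0 \<le> r" "r\<^sup>2 = 1 - t" using t by (simp_all add: r_def)
  have xz: "0 \<le> x" "0 \<le> z" by (simp_all add: x_def z_def)
  have "\<nu> (mvec n (perturb n M t) c) =
      \<nu> (\<lambda>i. of_real (1 - u) * (of_real r * a i + of_real t * mvec n ?P c i))"
  proof (rule cong)
    fix i assume i: "i < n"
    have "mvec n (perturb n M t) c i = (\<Sum>j<n. of_real (1 - u) * (of_real r *
        ((if i = j then c j else 0) - of_real (t / 2) * (?P i j * c j)) + of_real t * (?P i j * c j)))"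
    proof -
      have "perturb n M t i j * c j = of_real (1 - u) * (of_real r *
          ((if i = j then c j else 0) - of_real (t / 2) * (?P i j * c j)) + of_real t * (?P i j * c j))" for j
        unfolding perturb_def u_def[symmetric] r_def[symmetric] by (simp add: algebra_simps)
      then show ?thesis using i by (simp only: mvec_def if_True)
    qed
    also have "\<dots> = of_real (1 - u) * (of_real r *
        ((\<Sum>j<n. if i = j then c j else 0) - of_real (t / 2) * (\<Sum>j<n. ?P i j * c j)) +
         of_real t * (\<Sum>j<n. ?P i j * c j))"
      by (simp only: sum.distrib sum_subtractf flip: sum_distrib_left)
    also have "(\<Sum>j<n. if i = j then c j else 0) = c i"
      using i by simp
    finally show "mvec n (perturb n M t) c i =
        of_real (1 - u) * (of_real r * a i + of_real t * mvec n ?P c i)"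
      using i by (simp add: a_def mvec_def)
  qed
  also have "\<dots> \<le> (1 - u) * (r * \<nu> a + t * \<nu> (mvec n ?P c))"
    unfolding scale using triangle[of "\<lambda>i. of_real r * a i" "\<lambda>i. of_real t * mvec n ?P c i"] u r t
    unfolding scale by (simp del: of_real_diff add: mult_left_mono)
  also have "\<dots> \<le> (1 - u) * (r * x + t * z)"
    using u r t unit[of a] M[of "mvec n (adj M) c"]
    by (intro mult_left_mono add_mono) (auto simp: x_def z_def mvec_mmul)
  also have "\<dots> \<le> cnorm n c"
  proof (rule power2_le_imp_le)
    \<comment> \<open>Cauchy-Schwarz with its defect written out as a square.\<close>
    have "(r * x + t * z)\<^sup>2 = x\<^sup>2 + t * z\<^sup>2 - t * (x - r * z)\<^sup>2"
    proof -
      have t_eq: "t = 1 - r\<^sup>2" using r(2) by simp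
      show ?thesis
        unfolding t_eq by (simp add: power2_eq_square algebra_simps)
    qed
    also have "\<dots> \<le> x\<^sup>2 + t * z\<^sup>2" using t by simp
    also have "\<dots> = (cnorm n c)\<^sup>2 + t\<^sup>2 / 4 * (cnorm n (mvec n ?P c))\<^sup>2"
      unfolding x_def z_def a_def cnorm_perturb by simp
    also have "\<dots> \<le> (cnorm n c)\<^sup>2 + t\<^sup>2 / 4 * (hs2 n ?P * (cnorm n c)\<^sup>2)"
      using power_mono[OF cnorm_mvec_le[of n ?P c], of 2]
      by (intro add_left_mono mult_left_mono) (simp_all add: power_mult_distrib)
    finally have "(r * x + t * z)\<^sup>2 \<le> (1 + u) * (cnorm n c)\<^sup>2"
      by (simp add: u_def algebra_simps)
    \<comment> \<open>Shrinking by 1 - u suffices because (1 - u)^2 (1 + u) = (1 - u) (1 - u^2)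
      \<le> 1.\<close>
    then have "((1 - u) * (r * x + t * z))\<^sup>2 \<le> (1 - u)\<^sup>2 * ((1 + u) * (cnorm n c)\<^sup>2)"
      by (simp add: power_mult_distrib mult_left_mono)
    also have "\<dots> = (1 - u) * (1 - u\<^sup>2) * (cnorm n c)\<^sup>2"
      by (simp add: power2_eq_square algebra_simps)
    also have "\<dots> \<le> 1 * 1 * (cnorm n c)\<^sup>2"
      using u by (intro mult_right_mono mult_mono) (auto simp: power_le_one)
    finally show "((1 - u) * (r * x + t * z))\<^sup>2 \<le> (cnorm n c)\<^sup>2" by simp
  qed simp
  finally show ?thesis .
qed

text \<open>The modulus of the determinant measures the volume of the ellipsoid, and the admissible
  matrices, cut down to their n by n block, form a compact set.\<close>

lemma (in coord_norm) exists_max_mdet: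
  obtains A where "\<And>c. \<nu> (mvec n A c) \<le> cnorm n c" "mdet n A \<noteq> 0"
    "\<And>B. (\<And>c. \<nu> (mvec n B c) \<le> cnorm n c) \<Longrightarrow> norm (mdet n B) \<le> norm (mdet n A)"
proof -
  obtain k where k: "k > 0" "\<And>c. k * cnorm n c \<le> \<nu> c" using cnorm_le by blast
  obtain K where K: "K > 0" "\<And>c. \<nu> c \<le> K * cnorm n c" using le_cnorm by blast
  \<comment> \<open>Applying an admissible matrix to unit vector \<open>j\<close> bounds the entries
    of column \<open>j\<close> by 1 / k. Entries outside the block are set to 0 to keep the set
    compact.\<close>
  define box :: "(nat \<Rightarrow> nat \<Rightarrow> 'a) set" where
    "box = {A. \<forall>i. A i \<in> {f. \<forall>j. f j \<in> (if i < n \<and> j < n then cball 0 (1 / k) else {0})}}"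
  define S where "S = box \<inter> (\<Inter>c. {A. \<nu> (mvec n A c) \<le> cnorm n c})"
  have trunc: "(\<lambda>i j. if i < n \<and> j < n then B i j else 0) \<in> S"
    if B: "\<And>c. \<nu> (mvec n B c) \<le> cnorm n c" for B
  proof -
    have "norm (B i j) \<le> 1 / k" if "i < n" "j < n" for i j
    proof -
      let ?u = "\<lambda>m. if m = j then 1 else 0 :: 'a"
      have "mvec n B ?u i = B i j"
        using that by (simp add: mvec_def if_distrib[of "\<lambda>x. _ * x"] cong: if_cong)
      then have "k * norm (B i j) \<le> k * cnorm n (mvec n B ?u)"
        using norm_le_cnorm[OF that(1), of "mvec n B ?u"] k(1) by simp
      also have "\<dots> \<le> cnorm n ?u" using k(2) B order_trans by blast
      also have "(cnorm n ?u)\<^sup>2 = (\<Sum>m<n. if m = j then 1 else 0)"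
        unfolding cnorm_power2 by (rule sum.cong) auto
      then have "cnorm n ?u = 1"
        using that(2) cnorm_nonneg[of n ?u] by (auto simp: power2_eq_1_iff simp del: cnorm_nonneg)
      finally show ?thesis using k(1) by (simp add: field_simps)
    qed
    moreover have "mvec n (\<lambda>i j. if i < n \<and> j < n then B i j else 0) c = mvec n B c" for c
      by (rule mvec_cong) auto
    ultimately show ?thesis using B by (simp add: S_def box_def)
  qed
  have "compact box"
    unfolding box_def by (intro compact_box) auto
  moreover have "closed {A. \<nu> (mvec n A c) \<le> cnorm n c}" for c
  proof (rule closed_Collect_le)
    have ent: "continuous_on UNIV (\<lambda>A :: nat \<Rightarrow> nat \<Rightarrow> 'a. A i j)" for i j
      by (rule continuous_on_product_then_coordinatewise) simp
    have "continuous_on UNIV (\<lambda>A. mvec n A c)"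
    proof (rule continuous_on_coordinatewise_then_product)
      fix i
      show "continuous_on UNIV (\<lambda>A. mvec n A c i)"
        unfolding mvec_def by (cases "i < n") (simp_all add: continuous_intros ent)
    qed
    then show "continuous_on UNIV (\<lambda>A. \<nu> (mvec n A c))"
      using continuous continuous_on_compose2 by blast
  qed simp
  ultimately have "compact S"
    unfolding S_def by (intro compact_Int_closed closed_INT) auto
  \<comment> \<open>Scaling by 1 / K is admissible and invertible: it shows that \<open>S\<close> is
    nonempty and that the maximal determinant is not 0.\<close>
  have scalar: "\<nu> (mvec n (\<lambda>i j. if i = j then of_real (1 / K) else 0) c) \<le> cnorm n c" for c
  proof -
    have "\<nu> (mvec n (\<lambda>i j. if i = j then of_real (1 / K) else 0) c) = \<nu> (\<lambda>i. of_real (1 / K) * c i)"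
      by (rule cong) (simp add: mvec_def if_distrib[of "\<lambda>x. x * _"] cong: if_cong)
    also have "\<dots> \<le> cnorm n c"
      using K unfolding scale by (simp add: field_simps norm_divide)
    finally show ?thesis .
  qed
  have "S \<noteq> {}" using trunc[OF scalar] by blast
  moreover have "continuous_on S (\<lambda>A. norm (mdet n A))"
    by (intro continuous_on_norm continuous_on_subset[OF continuous_on_mdet]) simp
  ultimately obtain A where A: "A \<in> S" "\<And>B. B \<in> S \<Longrightarrow> norm (mdet n B) \<le> norm (mdet n A)"
    using continuous_attains_sup[OF \<open>compact S\<close>, of "\<lambda>A. norm (mdet n A)"] by blast
  have max: "norm (mdet n B) \<le> norm (mdet n A)" if "\<And>c. \<nu> (mvec n B c) \<le> cnorm n c" for B
  proof -
    have "mdet n B = mdet n (\<lambda>i j. if i < n \<and> j < n then B i j else 0)"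
      by (rule mdet_cong) simp
    then show ?thesis using A(2)[OF trunc[OF that]] by simp
  qed
  have "mdet n A \<noteq> 0"
  proof
    assume "mdet n A = 0"
    then have 0: "mdet n (\<lambda>i j. if i = j then of_real (1 / K) else 0 :: 'a) = 0"
      using max[OF scalar] by simp
    have "mmul n (\<lambda>i j. if i = j then of_real (1 / K) else 0) (\<lambda>i j. if i = j then of_real K else 0) i j
        = (if i = j then 1 else 0 :: 'a)" if "i < n" "j < n" for i j
      using that K(1) by (simp add: mmul_def if_distrib[of "\<lambda>x. x * _"] cong: if_cong)
    then have "mdet n (mmul n (\<lambda>i j. if i = j then of_real (1 / K) else 0)
        (\<lambda>i j. if i = j then of_real K else 0)) = (1 :: 'a)"
      by (intro trans[OF mdet_cong mdet_unit]) auto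
    then show False using 0 by (simp add: mdet_mmul)
  qed
  moreover have "\<nu> (mvec n A c) \<le> cnorm n c" for c
    using A(1) by (simp add: S_def)
  ultimately show ?thesis using that max by blast
qed

text \<open>Normalize by a volume maximizer \<open>A\<close>. A competitor \<open>M\<close> with hs2
  n M > n would make \<open>A\<close> times a perturbation admissible, with a determinant of larger
  modulus.\<close>

lemma john_exists:
  fixes \<nu> :: "(nat \<Rightarrow> 'k) \<Rightarrow> real"
  assumes "coord_norm n \<nu>"
  obtains A B where "is_inverse n A B" "john n (\<lambda>c. \<nu> (mvec n A c))"
proof -
  interpret coord_norm n \<nu> by fact
  obtain A where A: "\<And>c. \<nu> (mvec n A c) \<le> cnorm n c" "mdet n A \<noteq> 0" and
    max: "\<And>B. (\<And>c. \<nu> (mvec n B c) \<le> cnorm n c) \<Longrightarrow> norm (mdet n B) \<le> norm (mdet n A)"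
    using exists_max_mdet by blast
  obtain B where B: "is_inverse n A B" using mdet_nonzero_inverse[OF A(2)] .
  have "hs2 n M \<le> real n" if M: "\<forall>c. \<nu> (mvec n A (mvec n M c)) \<le> cnorm n c" for M
  proof (rule ccontr)
    assume "\<not> hs2 n M \<le> real n"
    define \<tau> where "\<tau> = hs2 n (mmul n M (adj M))"
    have "0 \<le> \<tau>" by (simp add: \<tau>_def)
    \<comment> \<open>Chosen so that t < \<delta> gives both t \<le> 1 and t^2 * \<tau> / 4 \<le> 1,
      as \<open>perturb_le_cnorm\<close> demands.\<close>
    define \<delta> where "\<delta> = 1 / (1 + \<tau>)"
    have "\<delta> > 0" using \<open>0 \<le> \<tau>\<close> by (simp add: \<delta>_def)
    moreover have "real n < hs2 n M" using \<open>\<not> hs2 n M \<le> real n\<close> by simp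
    ultimately obtain t where t: "0 < t" "t < \<delta>" and gt: "norm (mdet n (perturb n M t)) > 1"
      using exists_mdet_perturb_gt_1 by blast
    have "\<delta> \<le> 1" using \<open>0 \<le> \<tau>\<close> by (simp add: \<delta>_def)
    then have "t\<^sup>2 \<le> t" using t by (simp add: power2_eq_square mult_left_le)
    then have "t\<^sup>2 * \<tau> \<le> t * (1 + \<tau>)" using \<open>0 \<le> \<tau>\<close> t by (intro mult_mono) auto
    also have "\<dots> \<le> \<delta> * (1 + \<tau>)" using \<open>0 \<le> \<tau>\<close> t by (intro mult_right_mono) auto
    also have "\<dots> = 1" using \<open>0 \<le> \<tau>\<close> by (simp add: \<delta>_def)
    finally have "t\<^sup>2 * \<tau> / 4 \<le> 1" by simp
    have "\<nu> (mvec n (mmul n A (perturb n M t)) c) \<le> cnorm n c" for c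
      unfolding mvec_mmul
    proof (rule perturb_le_cnorm[OF mvec])
      show "0 \<le> t" "t \<le> 1" using t \<open>\<delta> \<le> 1\<close> by auto
      show "t\<^sup>2 * hs2 n (mmul n M (adj M)) / 4 \<le> 1"
        using \<open>t\<^sup>2 * \<tau> / 4 \<le> 1\<close> by (simp add: \<tau>_def)
    qed (use A(1) M in auto)
    then have "norm (mdet n (mmul n A (perturb n M t))) \<le> norm (mdet n A)" by (rule max)
    then show False using A(2) gt by (simp add: mdet_mmul norm_mult)
  qed
  then have "john n (\<lambda>c. \<nu> (mvec n A c))" using A(1) by (simp add: john_def)
  then show ?thesis using that B by blast
qed

text \<open>The competitor that sends the first unit vector to c / \<nu> c and the others to 0 has
  Hilbert-Schmidt norm cnorm n c / \<nu> c, which optimality bounds by sqrt n.\<close>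

lemma john_cnorm_le:
  assumes "john n \<nu>" "coord_norm n \<nu>"
  shows "cnorm n c \<le> sqrt n * \<nu> c"
proof (cases "\<nu> c = 0")
  case True
  then show ?thesis
    using assms(2) coord_norm.eq_0 cnorm_eq_0_iff[of n c] by fastforce
next
  case False
  interpret coord_norm n \<nu> by fact
  have pos: "\<nu> c > 0" using False nonneg[of c] by linarith
  define M where "M = (\<lambda>i j::nat. if j = 0 then of_real (inverse (\<nu> c)) * c i else 0)"
  show ?thesis
  proof (cases "n = 0")
    case True
    then show ?thesis by (simp add: cnorm_def)
  next
    case n: False
    have "\<nu> (mvec n M d) \<le> cnorm n d" for d
    proof -
      have "\<nu> (mvec n M d) = \<nu> (\<lambda>i. (of_real (inverse (\<nu> c)) * d 0) * c i)"
        by (rule cong) (use n in \<open>simp add: mvec_def M_def if_distrib[of "\<lambda>x. x * _"] cong: if_cong\<close>)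
      also have "\<dots> = norm (d 0)"
        using pos unfolding scale by (simp add: norm_mult norm_inverse)
      also have "\<dots> \<le> cnorm n d" using n by (intro norm_le_cnorm) simp
      finally show ?thesis .
    qed
    then have "hs2 n M \<le> real n" using assms(1) by (simp add: john_def)
    also have "hs2 n M = (\<Sum>i<n. (inverse (\<nu> c))\<^sup>2 * (norm (c i))\<^sup>2)"
      unfolding hs2_def M_def using n
      by (auto simp: if_distrib[of norm] if_distrib[of "\<lambda>x. x\<^sup>2"] norm_mult norm_inverse power_mult_distrib
          cong: if_cong intro!: sum.cong)
    also have "\<dots> = (cnorm n c / \<nu> c)\<^sup>2"
      by (simp add: cnorm_power2 power_divide sum_divide_distrib field_simps)
    finally have "cnorm n c / \<nu> c \<le> sqrt n"
      by (rule real_le_rsqrt)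
    then show ?thesis using pos by (simp add: field_simps)
  qed
qed

text \<open>Writing \<open>W = M\<^sup>-\<^sup>1\<close>, the optimality of both balls bounds \<open>\<parallel>W - M\<^sup>*\<parallel>\<^sup>2 = \<parallel>W\<parallel>\<^sup>2 + \<parallel>M\<parallel>\<^sup>2 - 2n\<close> in the
  Hilbert--Schmidt norm, so that \<open>W\<close> is nearly unitary.\<close>
lemma john_stability:
  fixes \<nu> \<nu>' :: "(nat \<Rightarrow> 'k) \<Rightarrow> real"
  assumes j: "john n \<nu>" "john n (\<lambda>c. \<nu>' (mvec n M c))"
    and sn: "coord_seminorm n \<nu>" "coord_seminorm n \<nu>'"
    and inv: "is_inverse n M W"
    and \<eta>: "\<eta> \<ge> 1" and le: "\<And>c. \<nu>' c \<le> \<eta> * \<nu> c" "\<And>c. \<nu> c \<le> \<eta> * \<nu>' c"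
  shows "\<bar>(cnorm n (mvec n W c))\<^sup>2 - (cnorm n c)\<^sup>2\<bar>
     \<le> sqrt (2 * n * (\<eta>\<^sup>2 - 1)) * cnorm n (mvec n W c) * cnorm n c"
proof -
  interpret a: coord_seminorm n \<nu> by fact
  interpret b: coord_seminorm n \<nu>' by fact
  have pos: "\<eta> > 0" using \<eta> by linarith
  \<comment> \<open>A map that is a competitor up to the factor \<eta> becomes one after division by
    \<eta>. This is used for \<open>M\<close> against \<nu> and for \<open>W\<close> against the
    transported \<nu>'.\<close>
  have bound: "hs2 n N \<le> n * \<eta>\<^sup>2"
    if "john n \<mu>" "coord_seminorm n \<mu>" "\<And>c. \<mu> (mvec n N c) \<le> \<eta> * cnorm n c" for N \<mu>
  proof -
    interpret coord_seminorm n \<mu> by fact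
    have "\<mu> (mvec n (\<lambda>i j. of_real (inverse \<eta>) * N i j) c) \<le> cnorm n c" for c
      unfolding mvec_scale_matrix scale using that(3)[of c] pos
      by (simp add: norm_inverse norm_divide field_simps)
    then have "hs2 n (\<lambda>i j. of_real (inverse \<eta>) * N i j) \<le> n"
      using that(1) by (simp add: john_def)
    then show ?thesis using pos
      unfolding hs2_scale by (simp add: norm_inverse norm_divide power_divide field_simps)
  qed
  have "hs2 n M \<le> n * \<eta>\<^sup>2"
  proof (rule bound[OF j(1) sn(1)])
    fix c
    have "\<nu> (mvec n M c) \<le> \<eta> * \<nu>' (mvec n M c)" by (rule le)
    also have "\<dots> \<le> \<eta> * cnorm n c" using j(2) pos by (simp add: john_def)
    finally show "\<nu> (mvec n M c) \<le> \<eta> * cnorm n c" .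
  qed
  moreover have "hs2 n W \<le> n * \<eta>\<^sup>2"
  proof (rule bound[OF j(2) b.mvec])
    fix c
    have "\<nu>' (mvec n M (mvec n W c)) = \<nu>' c"
      by (rule b.cong) (rule mvec_inverse[OF inv])
    also have "\<dots> \<le> \<eta> * \<nu> c" by (rule le)
    also have "\<dots> \<le> \<eta> * cnorm n c" using j(1) pos by (simp add: john_def)
    finally show "\<nu>' (mvec n M (mvec n W c)) \<le> \<eta> * cnorm n c" .
  qed
  moreover have "hs2 n (\<lambda>i j. W i j - adj M i j) = hs2 n W + hs2 n M - 2 * n"
  proof -
    \<comment> \<open>The cross terms of the expansion are the trace of W M = I and its conjugate,
      each equal to n.\<close>
    have tr: "(\<Sum>i<n. \<Sum>j<n. W i j * M j i) = of_nat n"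
    proof -
      have "(\<Sum>i<n. mmul n W M i i) = (\<Sum>i<n. 1)"
        using inv by (intro sum.cong) (auto simp: is_inverse_def)
      then show ?thesis by (simp add: mmul_def)
    qed
    have "cj (\<Sum>i<n. \<Sum>j<n. W i j * M j i) = of_nat n"
      using cj_of_real[of "real n"] by (simp add: tr)
    then have tr': "(\<Sum>i<n. \<Sum>j<n. cj (W i j) * cj (M j i)) = of_nat n"
      by (simp add: cj_sum cj_mult)
    have hsM: "(\<Sum>i<n. \<Sum>j<n. M j i * cj (M j i)) = of_real (hs2 n M)"
      by (simp add: mult_cj hs2_def) (rule sum.swap)
    have "(of_real (hs2 n (\<lambda>i j. W i j - adj M i j)) :: 'k) =
       (\<Sum>i<n. \<Sum>j<n. (W i j - cj (M j i)) * cj (W i j - cj (M j i)))"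
      by (simp add: hs2_def mult_cj adj_def)
    also have "\<dots> = (\<Sum>i<n. \<Sum>j<n. W i j * cj (W i j)) + (\<Sum>i<n. \<Sum>j<n. M j i * cj (M j i))
        - (\<Sum>i<n. \<Sum>j<n. W i j * M j i) - (\<Sum>i<n. \<Sum>j<n. cj (W i j) * cj (M j i))"
      by (simp add: cj_diff algebra_simps sum.distrib sum_subtractf)
    also have "\<dots> = of_real (hs2 n W + hs2 n M - 2 * n)"
      unfolding tr tr' hsM by (simp add: mult_cj hs2_def)
    finally show ?thesis by (simp only: of_real_eq_iff)
  qed
  ultimately have hs: "hs2 n (\<lambda>i j. W i j - adj M i j) \<le> 2 * n * (\<eta>\<^sup>2 - 1)"
    by (simp add: algebra_simps)
  have "mvec n M (mvec n W c) i = c i" if "i < n" for i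
    using mvec_inverse[OF inv that] .
  \<comment> \<open>Moving \<open>M\<close> to the other side pairs W c with M^H c, so the
    difference of the squared lengths is the inner product of W c with (W - M^H) c.\<close>
  then have "ip n (mvec n M (mvec n W c)) c = ip n c c"
    by (simp add: ip_def)
  then have "ip n (mvec n W c) (mvec n (adj M) c) = ip n c c"
    by (simp add: ip_mvec[of n M])
  then have "of_real ((cnorm n (mvec n W c))\<^sup>2 - (cnorm n c)\<^sup>2) =
      ip n (mvec n W c) (mvec n (\<lambda>i j. W i j - adj M i j) c)"
    by (simp add: mvec_diff_matrix ip_diff_right ip_self)
  then have "\<bar>(cnorm n (mvec n W c))\<^sup>2 - (cnorm n c)\<^sup>2\<bar> =
      norm (ip n (mvec n W c) (mvec n (\<lambda>i j. W i j - adj M i j) c))"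
    by (metis norm_of_real)
  also have "\<dots> \<le> cnorm n (mvec n W c) * cnorm n (mvec n (\<lambda>i j. W i j - adj M i j) c)"
    by (rule norm_ip_le)
  also have "\<dots> \<le> cnorm n (mvec n W c) * (sqrt (2 * n * (\<eta>\<^sup>2 - 1)) * cnorm n c)"
    using hs by (intro mult_left_mono order_trans[OF cnorm_mvec_le] mult_right_mono) auto
  finally show ?thesis by (simp add: mult_ac)
qed

end

section \<open>Coordinates on a fibre\<close>

text \<open>Fibres are sets inside a total space and not types, hence the elementary vector space
  calculus on a carrier \<open>S\<close>.\<close>

locale fibre_structure =
  fixes S :: "'e set" and add :: "'e \<Rightarrow> 'e \<Rightarrow> 'e"
    and sc :: "'k::{real_normed_field, heine_borel} \<Rightarrow> 'e \<Rightarrow> 'e" and z :: 'e and nrm :: "'e \<Rightarrow> real"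
  assumes banach: "banach_structure S add sc z nrm"
begin

lemma zero_closed: "z \<in> S"
  and add_closed [rule_format]: "\<forall>p\<in>S. \<forall>q\<in>S. add p q \<in> S"
  and sc_closed [rule_format]: "\<forall>a. \<forall>p\<in>S. sc a p \<in> S"
  and add_assoc [rule_format]: "\<forall>p\<in>S. \<forall>q\<in>S. \<forall>r\<in>S. add (add p q) r = add p (add q r)"
  and add_commute [rule_format]: "\<forall>p\<in>S. \<forall>q\<in>S. add p q = add q p"
  and add_0 [rule_format]: "\<forall>p\<in>S. add z p = p"
  and add_inverse [rule_format]: "\<forall>p\<in>S. \<exists>q\<in>S. add p q = z"
  and sc_add [rule_format]: "\<forall>a. \<forall>p\<in>S. \<forall>q\<in>S. sc a (add p q) = add (sc a p) (sc a q)"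
  and add_sc [rule_format]: "\<forall>a b. \<forall>p\<in>S. sc (a + b) p = add (sc a p) (sc b p)"
  and sc_sc [rule_format]: "\<forall>a b. \<forall>p\<in>S. sc (a * b) p = sc a (sc b p)"
  and sc_1 [rule_format]: "\<forall>p\<in>S. sc 1 p = p"
  and nrm_nonneg [rule_format]: "\<forall>p\<in>S. 0 \<le> nrm p"
  and nrm_eq_0 [rule_format]: "\<forall>p\<in>S. nrm p = 0 \<longleftrightarrow> p = z"
  and nrm_sc [rule_format]: "\<forall>a. \<forall>p\<in>S. nrm (sc a p) = norm a * nrm p"
  and nrm_add [rule_format]: "\<forall>p\<in>S. \<forall>q\<in>S. nrm (add p q) \<le> nrm p + nrm q"
  by (insert banach, unfold banach_structure_def, (elim conjE, assumption)+)

lemma complete: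
  assumes "\<And>m. f m \<in> S"
    and "\<And>\<epsilon>. \<epsilon> > 0 \<Longrightarrow> \<exists>N. \<forall>m\<ge>N. \<forall>k\<ge>N. nrm (add (f m) (sc (- 1) (f k))) < \<epsilon>"
  shows "\<exists>L\<in>S. (\<lambda>m::nat. nrm (add (f m) (sc (- 1) L))) \<longlonglongrightarrow> 0"
  using banach assms unfolding banach_structure_def by blast

lemma add_0_right: "p \<in> S \<Longrightarrow> add p z = p"
  using add_0 add_commute zero_closed by metis

lemma add_left_commute: "p \<in> S \<Longrightarrow> q \<in> S \<Longrightarrow> r \<in> S \<Longrightarrow> add p (add q r) = add q (add p r)"
  by (metis add_assoc add_commute)

lemma sc_0: assumes "p \<in> S" shows "sc 0 p = z"
proof -
  have s: "sc 0 p \<in> S" using assms by (rule sc_closed)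
  obtain q where q: "q \<in> S" "add (sc 0 p) q = z" using add_inverse[OF s] by blast
  have "add (sc 0 p) (sc 0 p) = sc 0 p" using add_sc[OF assms, of 0 0] by simp
  then have "add (sc 0 p) (add (sc 0 p) q) = add (sc 0 p) q"
    using add_assoc[OF s s q(1)] by simp
  then show ?thesis using q(2) s add_0_right by simp
qed

lemma sc_zero: "sc a z = z"
  by (metis mult_zero_right sc_0 sc_sc zero_closed)

lemma add_uminus: "p \<in> S \<Longrightarrow> add p (sc (- 1) p) = z"
  using add_sc[of p 1 "- 1"] by (simp add: sc_1 sc_0)

lemma diff_add_cancel: "p \<in> S \<Longrightarrow> q \<in> S \<Longrightarrow> add (add p (sc (- 1) q)) q = p"
  by (metis add_0_right add_assoc add_commute add_uminus sc_closed)

definition lin :: "nat \<Rightarrow> (nat \<Rightarrow> 'e) \<Rightarrow> (nat \<Rightarrow> 'k) \<Rightarrow> 'e" where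
  "lin n e c = fsum add z (\<lambda>i. sc (c i) (e i)) n"

lemma lin_0 [simp]: "lin 0 e c = z"
  and lin_Suc: "lin (Suc n) e c = add (lin n e c) (sc (c n) (e n))"
  by (simp_all add: lin_def)

lemma lin_closed: "(\<And>i. i < n \<Longrightarrow> e i \<in> S) \<Longrightarrow> lin n e c \<in> S"
  by (induction n) (auto simp: lin_Suc zero_closed add_closed sc_closed)

lemma lin_cong:
  "(\<And>i. i < n \<Longrightarrow> e i = e' i) \<Longrightarrow> (\<And>i. i < n \<Longrightarrow> c i = d i) \<Longrightarrow> lin n e c = lin n e' d"
  by (induction n) (auto simp: lin_Suc)

lemma lin_add:
  "(\<And>i. i < n \<Longrightarrow> e i \<in> S) \<Longrightarrow> lin n e (\<lambda>i. c i + d i) = add (lin n e c) (lin n e d)"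
proof (induction n)
  case (Suc n)
  then have "lin n e c \<in> S" "lin n e d \<in> S" "e n \<in> S" by (auto intro: lin_closed)
  then show ?case
    using Suc by (simp add: lin_Suc add_sc add_assoc add_left_commute add_closed sc_closed)
qed (simp add: add_0 zero_closed)

lemma lin_scale:
  "(\<And>i. i < n \<Longrightarrow> e i \<in> S) \<Longrightarrow> lin n e (\<lambda>i. a * c i) = sc a (lin n e c)"
  by (induction n) (auto simp: lin_Suc sc_zero sc_sc sc_add lin_closed sc_closed)

text \<open>The columns of \<open>A\<close>, read as coordinates, are the vectors of a new system;
  coordinates in it are carried to the old ones by \<open>A\<close>.\<close>

lemma lin_mvec:
  assumes e: "\<And>i. i < n \<Longrightarrow> e i \<in> S"
  shows "lin n (\<lambda>j. lin n e (\<lambda>i. A i j)) c = lin n e (mvec n A c)"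
proof -
  \<comment> \<open>The induction runs over the number \<open>k\<close> of columns only; the length
    \<open>n\<close> of the inner combinations stays fixed.\<close>
  have "lin k (\<lambda>j. lin n e (\<lambda>i. A i j)) c = lin n e (\<lambda>i. \<Sum>j<k. A i j * c j)" for k
  proof (induction k)
    case 0
    have "lin n e (\<lambda>i. 0 * 0) = sc 0 (lin n e (\<lambda>i. 0))" by (rule lin_scale) (rule e)
    then show ?case using e by (simp add: sc_0 lin_closed)
  next
    case (Suc k)
    have "lin n e (\<lambda>i. (\<Sum>j<k. A i j * c j) + c k * A i k) =
        add (lin n e (\<lambda>i. \<Sum>j<k. A i j * c j)) (sc (c k) (lin n e (\<lambda>i. A i k)))"
      using e by (simp add: lin_add lin_scale)
    then show ?case using Suc by (simp add: lin_Suc mult.commute)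
  qed
  then show ?thesis by (auto simp: mvec_def intro!: lin_cong)
qed

lemma coord_seminorm_lin:
  assumes e: "\<And>i. i < n \<Longrightarrow> e i \<in> S"
  shows "coord_seminorm n (\<lambda>c. nrm (lin n e c))"
proof
  show "nrm (lin n e (\<lambda>i. c i + d i)) \<le> nrm (lin n e c) + nrm (lin n e d)" for c d
    using e by (simp add: lin_add nrm_add lin_closed)
  show "nrm (lin n e (\<lambda>i. a * c i)) = norm a * nrm (lin n e c)" for a c
    using e by (simp add: lin_scale nrm_sc lin_closed)
  show "nrm (lin n e c) = nrm (lin n e d)" if "\<And>i. i < n \<Longrightarrow> c i = d i" for c d
    using lin_cong[of n e e c d] that by simp
qed

section \<open>Bases, coordinates and change of basis in a fibre\<close>

definition basis :: "nat \<Rightarrow> (nat \<Rightarrow> 'e) \<Rightarrow> bool" where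
  "basis n e \<longleftrightarrow> (\<forall>i<n. e i \<in> S) \<and> (\<forall>v\<in>S. \<exists>!c. (\<forall>i\<ge>n. c i = 0) \<and> v = lin n e c)"

definition coords :: "nat \<Rightarrow> (nat \<Rightarrow> 'e) \<Rightarrow> 'e \<Rightarrow> nat \<Rightarrow> 'k" where
  "coords n e v = (THE c. (\<forall>i\<ge>n. c i = 0) \<and> v = lin n e c)"

lemma basisD: "basis n e \<Longrightarrow> i < n \<Longrightarrow> e i \<in> S"
  by (simp add: basis_def)

lemma
  assumes "basis n e" "v \<in> S"
  shows lin_coords: "lin n e (coords n e v) = v"
    and coords_zero: "i \<ge> n \<Longrightarrow> coords n e v i = 0"
proof -
  have "\<exists>!c. (\<forall>i\<ge>n. c i = 0) \<and> v = lin n e c"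
    using assms by (simp add: basis_def)
  from theI'[OF this] show "lin n e (coords n e v) = v" "i \<ge> n \<Longrightarrow> coords n e v i = 0"
    by (simp_all add: coords_def)
qed

lemma coords_eqI:
  "basis n e \<Longrightarrow> v \<in> S \<Longrightarrow> \<forall>i\<ge>n. c i = 0 \<Longrightarrow> v = lin n e c \<Longrightarrow> coords n e v = c"
  unfolding basis_def coords_def by (intro the1_equality) auto

lemma coords_lin:
  assumes "basis n e" "i < n"
  shows "coords n e (lin n e c) i = c i"
proof -
  have "lin n e c = lin n e (\<lambda>i. if i < n then c i else 0)"
    by (rule lin_cong) auto
  then have "coords n e (lin n e c) = (\<lambda>i. if i < n then c i else 0)"
    using assms(1) by (intro coords_eqI) (auto intro: lin_closed basisD)
  then show ?thesis using assms(2) by simp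
qed

lemma coords_add:
  assumes "basis n e" "v \<in> S" "w \<in> S"
  shows "coords n e (add v w) = (\<lambda>i. coords n e v i + coords n e w i)"
  using assms by (intro coords_eqI) (auto simp: coords_zero lin_add lin_coords add_closed basisD)

lemma coords_sc:
  assumes "basis n e" "v \<in> S"
  shows "coords n e (sc a v) = (\<lambda>i. a * coords n e v i)"
  using assms by (intro coords_eqI) (auto simp: coords_zero lin_scale lin_coords sc_closed basisD)

lemma lin_eq_zero:
  assumes "basis n e" "lin n e c = z" "i < n"
  shows "c i = 0"
proof -
  have "coords n e (sc 0 z) i = 0" using assms(1) by (simp add: coords_sc zero_closed)
  then show ?thesis using coords_lin[OF assms(1,3), of c] assms(2) by (simp add: sc_zero)
qed

lemma coord_norm_lin:
  assumes "basis n e"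
  shows "coord_norm n (\<lambda>c. nrm (lin n e c))"
proof -
  interpret coord_seminorm n "\<lambda>c. nrm (lin n e c)"
    using assms by (intro coord_seminorm_lin basisD)
  show ?thesis
    by unfold_locales (metis assms basisD lin_closed lin_eq_zero nrm_eq_0)
qed

lemma basis_change:
  assumes e: "basis n e" and inv: "is_inverse n A B"
  shows "basis n (\<lambda>j. lin n e (\<lambda>i. A i j))"
  unfolding basis_def
proof (intro conjI allI impI ballI ex_ex1I)
  show "lin n e (\<lambda>i. A i j) \<in> S" for j using e by (intro lin_closed basisD)
  have lin: "lin n (\<lambda>j. lin n e (\<lambda>i. A i j)) c = lin n e (mvec n A c)" for c
    using e by (intro lin_mvec basisD)
  fix v assume v: "v \<in> S"
  have "lin n e (mvec n A (mvec n B (coords n e v))) = lin n e (coords n e v)"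
    by (rule lin_cong) (auto simp: mvec_inverse[OF inv])
  then have "v = lin n e (mvec n A (mvec n B (coords n e v)))"
    using lin_coords[OF e v] by simp
  then show "\<exists>c. (\<forall>i\<ge>n. c i = 0) \<and> v = lin n (\<lambda>j. lin n e (\<lambda>i. A i j)) c"
    unfolding lin by (intro exI[of _ "mvec n B (coords n e v)"]) (auto simp: mvec_def)
  fix c d
  assume c: "(\<forall>i\<ge>n. c i = 0) \<and> v = lin n (\<lambda>j. lin n e (\<lambda>i. A i j)) c"
    and d: "(\<forall>i\<ge>n. d i = 0) \<and> v = lin n (\<lambda>j. lin n e (\<lambda>i. A i j)) d"
  have "mvec n A c i = mvec n A d i" if "i < n" for i
    using c d coords_lin[OF e that, of "mvec n A c"] coords_lin[OF e that, of "mvec n A d"]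
    unfolding lin by simp
  then have "mvec n B (mvec n A c) = mvec n B (mvec n A d)"
    by (intro mvec_cong) auto
  then have "c i = d i" if "i < n" for i
    using mvec_inverse[OF is_inverse_sym[OF inv] that] by metis
  then show "c = d" using c d by (metis ext not_le)
qed

end

context conj_field
begin

lemma exists_john_basis:
  fixes add :: "'e \<Rightarrow> 'e \<Rightarrow> 'e" and sc :: "'k \<Rightarrow> 'e \<Rightarrow> 'e"
  assumes "fibre_structure S add sc z nrm" "fibre_structure.basis S add sc z n b"
  obtains e where "fibre_structure.basis S add sc z n e"
    "john n (\<lambda>c. nrm (fibre_structure.lin add sc z n e c))"
proof -
  interpret fibre_structure S add sc z nrm by fact
  obtain A B where A: "is_inverse n A B" "john n (\<lambda>c. nrm (lin n b (mvec n A c)))"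
    using john_exists[OF coord_norm_lin[OF assms(2)]] by blast
  have "lin n (\<lambda>j. lin n b (\<lambda>i. A i j)) c = lin n b (mvec n A c)" for c
    using assms(2) by (intro lin_mvec basisD)
  then show ?thesis using that basis_change[OF assms(2) A(1)] A(2) by auto
qed

end

section \<open>Linear combinations in nearby fibres\<close>

locale fbundle =
  fixes E :: "('x, 'e, 'k::{real_normed_field, heine_borel}) bbundle"
  assumes banach_bundle: "banach_bundle E"
begin

lemma continuous_proj: "continuous_map (tot E) (base E) (proj E)"
  and open_proj: "open_map (tot E) (base E) (proj E)"
  and surj_proj: "proj E ` topspace (tot E) = topspace (base E)"
  and continuous_bscale:
    "continuous_map (prod_topology euclidean (tot E)) (tot E) (\<lambda>(a, p). bscale E a p)"
  and continuous_badd: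
    "continuous_map (subtopology (prod_topology (tot E) (tot E)) {(p, q). proj E p = proj E q})
       (tot E) (\<lambda>(p, q). badd E p q)"
  and continuous_bnorm: "continuous_map (tot E) euclideanreal (bnorm E)"
  using banach_bundle by (simp_all add: banach_bundle_def)

lemma fibre_structure:
  "x \<in> topspace (base E) \<Longrightarrow>
     fibre_structure (fibre E x) (badd E) (bscale E) (bzero E x) (bnorm E)"
  using banach_bundle by (simp add: banach_bundle_def fibre_structure_def)

lemma fibreD: "p \<in> fibre E x \<Longrightarrow> p \<in> topspace (tot E)" "p \<in> fibre E x \<Longrightarrow> proj E p = x"
  by (simp_all add: fibre_def)

lemma fibre_proj: "p \<in> topspace (tot E) \<Longrightarrow> p \<in> fibre E (proj E p)"
  by (simp add: fibre_def)

lemma proj_in_base: "p \<in> topspace (tot E) \<Longrightarrow> proj E p \<in> topspace (base E)"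
  using surj_proj by auto

lemma zero_in_fibre: "x \<in> topspace (base E) \<Longrightarrow> bzero E x \<in> fibre E x"
  by (rule fibre_structure.zero_closed[OF fibre_structure])

lemma bnorm_zero: "x \<in> topspace (base E) \<Longrightarrow> bnorm E (bzero E x) = 0"
  using fibre_structure.nrm_eq_0[OF fibre_structure] zero_in_fibre by blast

lemma zero_neighbourhood:
  assumes "openin (tot E) W" "x \<in> topspace (base E)" "bzero E x \<in> W"
  obtains U \<epsilon> where "openin (base E) U" "x \<in> U" "\<epsilon> > 0"
    "{p \<in> topspace (tot E). proj E p \<in> U \<and> bnorm E p < \<epsilon>} \<subseteq> W"
proof -
  have "\<forall>x\<in>topspace (base E). \<forall>W. openin (tot E) W \<and> bzero E x \<in> W \<longrightarrow>
       (\<exists>U \<epsilon>. openin (base E) U \<and> x \<in> U \<and> \<epsilon> > 0 \<and>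
          {p \<in> topspace (tot E). proj E p \<in> U \<and> bnorm E p < \<epsilon>} \<subseteq> W)"
    using banach_bundle by (simp add: banach_bundle_def)
  then show ?thesis using assms that by blast
qed

text \<open>A tube around the zero of one fibre contains the zeros of all nearby fibres.\<close>

lemma continuous_bzero: "continuous_map (base E) (tot E) (bzero E)"
  unfolding continuous_map_def
proof (intro conjI allI impI)
  show "bzero E \<in> topspace (base E) \<rightarrow> topspace (tot E)"
    using zero_in_fibre fibreD by blast
  fix W assume W: "openin (tot E) W"
  show "openin (base E) {x \<in> topspace (base E). bzero E x \<in> W}"
  proof (subst openin_subopen, safe)
    fix x assume "x \<in> topspace (base E)" "bzero E x \<in> W"
    with W obtain U \<epsilon> where U: "openin (base E) U" "x \<in> U" "\<epsilon> > 0"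
      "{p \<in> topspace (tot E). proj E p \<in> U \<and> bnorm E p < \<epsilon>} \<subseteq> W"
      by (rule zero_neighbourhood)
    have "bzero E y \<in> W" if "y \<in> U" for y
    proof -
      have y: "y \<in> topspace (base E)" using U(1) that openin_subset by blast
      show ?thesis
        using zero_in_fibre[OF y] bnorm_zero[OF y] U(3,4) that by (auto simp: fibre_def)
    qed
    then show "\<exists>T. openin (base E) T \<and> x \<in> T \<and> T \<subseteq> {x \<in> topspace (base E). bzero E x \<in> W}"
      using U(1,2) openin_subset by blast
  qed
qed

text \<open>Agrees with \<open>lin\<close> in the fibre over \<open>x\<close>. With \<open>x\<close>
  as an argument it can be studied while the base point, the vectors and the coefficients all
  vary.\<close>

definition comb :: "nat \<Rightarrow> 'x \<Rightarrow> (nat \<Rightarrow> 'e) \<Rightarrow> (nat \<Rightarrow> 'k) \<Rightarrow> 'e" where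
  "comb n x e c = fsum (badd E) (bzero E x) (\<lambda>i. bscale E (c i) (e i)) n"

lemma comb_eq_lin:
  "x \<in> topspace (base E) \<Longrightarrow> comb n x e c = fibre_structure.lin (badd E) (bscale E) (bzero E x) n e c"
  using fibre_structure.lin_def[OF fibre_structure] by (simp add: comb_def)

lemma comb_in_fibre:
  "x \<in> topspace (base E) \<Longrightarrow> (\<And>i. i < n \<Longrightarrow> e i \<in> fibre E x) \<Longrightarrow> comb n x e c \<in> fibre E x"
  using fibre_structure.lin_closed[OF fibre_structure] by (simp add: comb_eq_lin)

text \<open>The m-fold fibre product over the base. The base point is kept as a component: it
  determines the zero vector from which the sum starts, also when m = 0.\<close>

definition tuples :: "nat \<Rightarrow> ('x \<times> (nat \<Rightarrow> 'e)) topology" where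
  "tuples m = subtopology (prod_topology (base E) (product_topology (\<lambda>_. tot E) {..<m}))
     {(x, e). \<forall>i<m. proj E (e i) = x}"

lemma topspace_tuples:
  "(x, e) \<in> topspace (tuples m) \<longleftrightarrow>
     x \<in> topspace (base E) \<and> (\<forall>i<m. e i \<in> fibre E x) \<and> e \<in> extensional {..<m}"
  by (auto simp: tuples_def fibre_def PiE_iff)

text \<open>Induction on the number \<open>k\<close> of summands, with the space of m-tuples fixed
  so that the domain does not change.\<close>

lemma continuous_comb:
  "k \<le> m \<Longrightarrow> continuous_map (prod_topology (tuples m) euclidean) (tot E) (\<lambda>((x, e), c). comb k x e c)"
proof (induction k)
  let ?P = "prod_topology (tuples m) (euclidean :: (nat \<Rightarrow> 'k) topology)"
  have fst: "continuous_map ?P (prod_topology (base E) (product_topology (\<lambda>_. tot E) {..<m})) (\<lambda>y. fst y)"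
    using continuous_map_into_fulltopology[OF continuous_map_fst[of "tuples m" euclidean, unfolded tuples_def]]
    by (simp add: tuples_def)
  have base: "continuous_map ?P (base E) (\<lambda>y. fst (fst y))"
    using continuous_map_compose[OF fst continuous_map_fst] by (simp add: o_def)
  have elt: "continuous_map ?P (tot E) (\<lambda>y. snd (fst y) i)" if "i < m" for i
    using continuous_map_compose[OF continuous_map_compose[OF fst continuous_map_snd]
        continuous_map_product_projection[of i "{..<m}"]] that by (simp add: o_def)
  have coord: "continuous_map ?P euclidean (\<lambda>y. snd y i)" for i
    using continuous_map_compose[OF continuous_map_snd[of "tuples m" euclidean],
      of euclidean "\<lambda>c :: nat \<Rightarrow> 'k. c i"] by (simp add: o_def)
  {
    case 0
    show ?case
      using continuous_map_compose[OF base continuous_bzero]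
      by (simp add: comb_def o_def case_prod_unfold)
  next
    case (Suc k)
    have "continuous_map ?P (tot E) (\<lambda>y. bscale E (snd y k) (snd (fst y) k))"
      using continuous_map_compose[OF continuous_map_pairedI[OF coord elt[of k]] continuous_bscale] Suc.prems
      by (simp add: o_def)
    moreover have "continuous_map ?P (tot E) (\<lambda>((x, e), c). comb k x e c)"
      using Suc by simp
    ultimately have "continuous_map ?P (prod_topology (tot E) (tot E))
        (\<lambda>y. (comb k (fst (fst y)) (snd (fst y)) (snd y), bscale E (snd y k) (snd (fst y) k)))"
      by (intro continuous_map_pairedI) (auto simp: case_prod_unfold)
    \<comment> \<open>Addition is continuous only on pairs over a common base point, so the partial
      sum and the next summand must be seen to lie in one fibre.\<close>
    then have "continuous_map ?P (subtopology (prod_topology (tot E) (tot E)) {(p, q). proj E p = proj E q})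
        (\<lambda>y. (comb k (fst (fst y)) (snd (fst y)) (snd y), bscale E (snd y k) (snd (fst y) k)))"
    proof (rule continuous_map_into_subtopology, intro funcsetI)
      fix y assume y: "y \<in> topspace ?P"
      obtain x e c where [simp]: "y = ((x, e), c)" by (metis surj_pair)
      have x: "x \<in> topspace (base E)" and e: "\<And>i. i < m \<Longrightarrow> e i \<in> fibre E x"
        using y topspace_tuples[of x e m] by auto
      interpret fibre_structure "fibre E x" "badd E" "bscale E" "bzero E x" "bnorm E"
        using x by (rule fibre_structure)
      have "comb k x e c \<in> fibre E x" using comb_in_fibre[OF x] e Suc.prems by simp
      moreover have "bscale E (c k) (e k) \<in> fibre E x" using sc_closed e Suc.prems by simp
      ultimately show "(comb k (fst (fst y)) (snd (fst y)) (snd y), bscale E (snd y k) (snd (fst y) k))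
          \<in> {(p, q). proj E p = proj E q}"
        by (simp add: fibre_def)
    qed
    from continuous_map_compose[OF this continuous_badd]
    show ?case by (simp add: comb_def o_def case_prod_unfold)
  }
qed

lemma comb_restrict: "comb m x (restrict e {..<m}) c = comb m x e c"
proof -
  have "comb k x (restrict e {..<m}) c = comb k x e c" if "k \<le> m" for k
    using that by (induction k) (auto simp: comb_def)
  then show ?thesis by simp
qed

text \<open>The norm of a combination is jointly continuous, and the tube lemma makes the estimate
  uniform over the compact set \<open>K\<close> of coefficients. The neighbourhood has product form
  so that each vector may be picked in its own open set, independently of the others.\<close>

lemma bnorm_comb_nearby:
  assumes x0: "x0 \<in> topspace (base E)" and e: "\<And>i. i < m \<Longrightarrow> e i \<in> fibre E x0"
    and K: "compact K" and \<eta>: "\<eta> > 0"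
  obtains U W where "openin (base E) U" "x0 \<in> U"
    "\<And>i. i < m \<Longrightarrow> openin (tot E) (W i) \<and> e i \<in> W i"
    "\<And>x b c. x \<in> U \<Longrightarrow> (\<And>i. i < m \<Longrightarrow> b i \<in> W i \<inter> fibre E x) \<Longrightarrow> c \<in> K \<Longrightarrow>
       \<bar>bnorm E (comb m x b c) - bnorm E (comb m x0 e c)\<bar> < \<eta>"
proof -
  let ?P = "prod_topology (tuples m) (euclidean :: (nat \<Rightarrow> 'k) topology)"
  let ?e = "restrict e {..<m}"
  have y0: "(x0, ?e) \<in> topspace (tuples m)"
    using x0 e by (simp add: topspace_tuples)
  have f: "continuous_map ?P euclideanreal (\<lambda>y. bnorm E (comb m (fst (fst y)) (snd (fst y)) (snd y)))"
    using continuous_map_compose[OF continuous_comb[of m m] continuous_bnorm]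
    by (simp add: o_def case_prod_unfold)
  have "continuous_map ?P ?P (\<lambda>y. ((x0, ?e), snd y))"
    using y0 by (intro continuous_map_pairedI continuous_map_snd) simp
  from continuous_map_compose[OF this f]
  have g: "continuous_map ?P euclideanreal (\<lambda>y. bnorm E (comb m x0 e (snd y)))"
    by (simp add: o_def comb_restrict)
  have h: "continuous_map ?P euclideanreal
      (\<lambda>y. \<bar>bnorm E (comb m (fst (fst y)) (snd (fst y)) (snd y)) - bnorm E (comb m x0 e (snd y))\<bar>)"
    by (intro continuous_map_real_abs continuous_map_diff f g)
  define O1 where "O1 = {y \<in> topspace ?P.
      \<bar>bnorm E (comb m (fst (fst y)) (snd (fst y)) (snd y)) - bnorm E (comb m x0 e (snd y))\<bar> < \<eta>}"
  have "openin ?P {y \<in> topspace ?P.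
      \<bar>bnorm E (comb m (fst (fst y)) (snd (fst y)) (snd y)) - bnorm E (comb m x0 e (snd y))\<bar> \<in> {..<\<eta>}}"
    by (rule openin_continuous_map_preimage[OF h]) simp
  then have "openin ?P O1" by (simp add: O1_def)
  moreover have "{(x0, ?e)} \<times> K \<subseteq> O1"
    using y0 \<eta> by (auto simp: O1_def comb_restrict)
  ultimately obtain U1 V where U1: "openin (tuples m) U1" "(x0, ?e) \<in> U1" and V: "K \<subseteq> V" "U1 \<times> V \<subseteq> O1"
    using tube_lemma_right[of "tuples m" euclidean O1 K "(x0, ?e)"] y0 K by auto
  obtain U2 where U2: "openin (prod_topology (base E) (product_topology (\<lambda>_. tot E) {..<m})) U2"
    "U1 = U2 \<inter> {(x, e). \<forall>i<m. proj E (e i) = x}"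
    using U1(1) by (auto simp: tuples_def openin_subtopology)
  then have "(x0, ?e) \<in> U2" using U1(2) by simp
  from U2(1)[unfolded openin_prod_topology_alt, rule_format, OF this]
  obtain U B where U: "openin (base E) U" "x0 \<in> U" and
    B: "openin (product_topology (\<lambda>_. tot E) {..<m}) B" "?e \<in> B" "U \<times> B \<subseteq> U2"
    by auto
  from B(1)[unfolded openin_product_topology_alt, rule_format, OF B(2)]
  obtain W where W: "\<forall>i\<in>{..<m}. openin (tot E) (W i)" "?e \<in> PiE {..<m} W" "PiE {..<m} W \<subseteq> B"
    by auto
  show ?thesis
  proof (rule that[OF U])
    show "openin (tot E) (W i) \<and> e i \<in> W i" if "i < m" for i
      using W that by (auto simp: PiE_iff)
    fix x b c assume x: "x \<in> U" and b: "\<And>i. i < m \<Longrightarrow> b i \<in> W i \<inter> fibre E x" and c: "c \<in> K"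
    have "restrict b {..<m} \<in> PiE {..<m} W" using b by auto
    then have "(x, restrict b {..<m}) \<in> U2"
      using x W(3) B(3) by blast
    then have "(x, restrict b {..<m}) \<in> U1"
      using b by (simp add: U2(2) fibre_def)
    then have "((x, restrict b {..<m}), c) \<in> O1" using c V by blast
    then show "\<bar>bnorm E (comb m x b c) - bnorm E (comb m x0 e c)\<bar> < \<eta>"
      by (simp add: O1_def comb_restrict)
  qed
qed

end

section \<open>The John norm of a homogeneous bundle\<close>

locale hom_bundle = fbundle E + conj_field cj
  for E :: "('x, 'e, 'k::{real_normed_field, heine_borel}) bbundle" and cj :: "'k \<Rightarrow> 'k" +
  fixes n :: nat
  assumes homogeneous: "homogeneous n E"
begin

text \<open>An arbitrary choice in every fibre. By \<open>john_stability\<close> with \<eta> = 1,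
  two John bases of one fibre give the same Euclidean norm.\<close>

definition john_basis :: "'x \<Rightarrow> nat \<Rightarrow> 'e" where
  "john_basis x = (SOME e. fibre_structure.basis (fibre E x) (badd E) (bscale E) (bzero E x) n e \<and>
     john n (\<lambda>c. bnorm E (comb n x e c)))"

definition john_coords :: "'e \<Rightarrow> nat \<Rightarrow> 'k" where
  "john_coords v = fibre_structure.coords (badd E) (bscale E) (bzero E (proj E v)) n
     (john_basis (proj E v)) v"

definition john_norm :: "'e \<Rightarrow> real" where
  "john_norm v = cnorm n (john_coords v)"

lemma john_basis:
  assumes x: "x \<in> topspace (base E)"
  shows "fibre_structure.basis (fibre E x) (badd E) (bscale E) (bzero E x) n (john_basis x)"
    and "john n (\<lambda>c. bnorm E (comb n x (john_basis x) c))"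
proof -
  interpret fibre_structure "fibre E x" "badd E" "bscale E" "bzero E x" "bnorm E"
    using x by (rule fibre_structure)
  have "\<exists>b. basis n b"
    using homogeneous x by (simp add: homogeneous_def basis_def lin_def)
  then obtain b where "basis n b" ..
  from exists_john_basis[OF fibre_structure[OF x] this]
  obtain e where "basis n e" "john n (\<lambda>c. bnorm E (lin n e c))" .
  then have "\<exists>e. basis n e \<and> john n (\<lambda>c. bnorm E (comb n x e c))"
    unfolding comb_eq_lin[OF x] by (intro exI conjI)
  from someI_ex[OF this] show "basis n (john_basis x)" "john n (\<lambda>c. bnorm E (comb n x (john_basis x) c))"
    by (simp_all add: john_basis_def)
qed

end

locale hom_bundle_fibre = hom_bundle E cj n + fibre_structure "fibre E x" "badd E" "bscale E" "bzero E x" "bnorm E"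
  for E :: "('x, 'e, 'k::{real_normed_field, heine_borel}) bbundle" and cj :: "'k \<Rightarrow> 'k" and n x +
  assumes x: "x \<in> topspace (base E)"
begin

lemma basis_john: "basis n (john_basis x)"
  by (rule john_basis(1)[OF x])

lemma john_coords_eq: "v \<in> fibre E x \<Longrightarrow> john_coords v = coords n (john_basis x) v"
  by (simp add: john_coords_def fibre_def)

lemma comb_lin: "comb n x e c = lin n e c"
  by (rule comb_eq_lin[OF x])

lemma comb_john_coords: "v \<in> fibre E x \<Longrightarrow> comb n x (john_basis x) (john_coords v) = v"
  by (simp add: comb_lin john_coords_eq lin_coords basis_john)

lemma coord_norm_john: "coord_norm n (\<lambda>c. bnorm E (comb n x (john_basis x) c))"
  unfolding comb_lin by (rule coord_norm_lin[OF basis_john])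

lemma bnorm_le_john_norm: "v \<in> fibre E x \<Longrightarrow> bnorm E v \<le> john_norm v"
  using john_basis(2)[OF x] comb_john_coords[of v] unfolding john_def john_norm_def by metis

lemma john_norm_le: "v \<in> fibre E x \<Longrightarrow> john_norm v \<le> sqrt n * bnorm E v"
  using john_cnorm_le[OF john_basis(2)[OF x] coord_norm_john, of "john_coords v"]
  by (simp add: comb_john_coords john_norm_def)

lemma john_coords_add:
  "v \<in> fibre E x \<Longrightarrow> w \<in> fibre E x \<Longrightarrow>
     john_coords (badd E v w) = (\<lambda>i. john_coords v i + john_coords w i)"
  by (simp add: john_coords_eq add_closed coords_add[OF basis_john])

lemma john_coords_scale:
  "v \<in> fibre E x \<Longrightarrow> john_coords (bscale E a v) = (\<lambda>i. a * john_coords v i)"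
  by (simp add: john_coords_eq sc_closed coords_sc[OF basis_john])

lemma john_norm_add:
  "v \<in> fibre E x \<Longrightarrow> w \<in> fibre E x \<Longrightarrow> john_norm (badd E v w) \<le> john_norm v + john_norm w"
  by (simp add: john_norm_def john_coords_add cnorm_triangle)

lemma john_norm_scale: "v \<in> fibre E x \<Longrightarrow> john_norm (bscale E a v) = norm a * john_norm v"
  by (simp add: john_norm_def john_coords_scale cnorm_scale)

lemma john_norm_comb: "john_norm (comb n x (john_basis x) c) = cnorm n c"
proof -
  have "comb n x (john_basis x) c \<in> fibre E x"
    unfolding comb_lin using basis_john by (intro lin_closed basisD)
  then show ?thesis
    unfolding john_norm_def using coords_lin[OF basis_john]
    by (simp add: john_coords_eq) (simp add: comb_lin cong: cnorm_cong)
qed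

lemma john_norm_eq_0: "v \<in> fibre E x \<Longrightarrow> john_norm v = 0 \<longleftrightarrow> v = bzero E x"
  using bnorm_le_john_norm[of v] john_norm_le[of v] nrm_eq_0[of v] nrm_nonneg[of v]
  by (auto simp: john_norm_def intro: antisym)

text \<open>Allows a vector to be replaced by one that is close in the original norm.\<close>

lemma john_norm_diff:
  assumes "v \<in> fibre E x" "w \<in> fibre E x"
  shows "\<bar>john_norm v - john_norm w\<bar> \<le> sqrt n * bnorm E (badd E v (bscale E (- 1) w))"
proof -
  have cl: "badd E v (bscale E (- 1) w) \<in> fibre E x" using assms by (simp add: add_closed sc_closed)
  have "john_norm v \<le> john_norm (badd E v (bscale E (- 1) w)) + john_norm w"
    using john_norm_add[OF cl assms(2)] assms by (simp add: diff_add_cancel)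
  moreover have "john_norm w \<le> john_norm (badd E v (bscale E (- 1) w)) + john_norm v"
  proof -
    have "bscale E (- 1) (badd E v (bscale E (- 1) w)) = badd E w (bscale E (- 1) v)"
      using assms by (simp add: sc_add sc_closed sc_1 add_commute flip: sc_sc)
    then have "badd E (bscale E (- 1) (badd E v (bscale E (- 1) w))) v = w"
      using assms by (simp add: diff_add_cancel)
    then show ?thesis
      using john_norm_add[OF sc_closed[OF cl, of "- 1"] assms(1)] cl by (simp add: john_norm_scale)
  qed
  ultimately show ?thesis using john_norm_le[OF cl] by linarith
qed

text \<open>Completeness passes to the new norm because the two norms are equivalent.\<close>

lemma banach_structure_john:
  "banach_structure (fibre E x) (badd E) (bscale E) (bzero E x) john_norm"
proof -
  have "\<exists>L\<in>fibre E x. (\<lambda>m. john_norm (badd E (f m) (bscale E (- 1) L))) \<longlonglongrightarrow> 0"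
    if f: "\<And>m. f m \<in> fibre E x"
      and cauchy: "\<And>\<epsilon>. \<epsilon> > 0 \<Longrightarrow> \<exists>N. \<forall>m\<ge>N. \<forall>k\<ge>N. john_norm (badd E (f m) (bscale E (- 1) (f k))) < \<epsilon>"
    for f :: "nat \<Rightarrow> 'e"
  proof -
    have cl: "badd E (f m) (bscale E (- 1) L) \<in> fibre E x" if "L \<in> fibre E x" for m L
      using f that by (simp add: add_closed sc_closed)
    have "\<exists>N. \<forall>m\<ge>N. \<forall>k\<ge>N. bnorm E (badd E (f m) (bscale E (- 1) (f k))) < \<epsilon>" if "\<epsilon> > 0" for \<epsilon>
      using cauchy[OF that] bnorm_le_john_norm[OF cl[OF f]] by (meson le_less_trans)
    from complete[OF f this] obtain L where
      L: "L \<in> fibre E x" "(\<lambda>m. bnorm E (badd E (f m) (bscale E (- 1) L))) \<longlonglongrightarrow> 0" by blast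
    have "(\<lambda>m. sqrt n * bnorm E (badd E (f m) (bscale E (- 1) L))) \<longlonglongrightarrow> 0"
      using tendsto_mult_right_zero[OF L(2)] .
    then have "(\<lambda>m. john_norm (badd E (f m) (bscale E (- 1) L))) \<longlonglongrightarrow> 0"
      by (rule Lim_null_comparison[rotated])
        (use john_norm_le[OF cl[OF L(1)]] in \<open>simp add: john_norm_def\<close>)
    then show ?thesis using L(1) by blast
  qed
  then show ?thesis
    using john_norm_eq_0 john_norm_scale john_norm_add
    unfolding banach_structure_def
    by (simp add: zero_closed add_closed sc_closed add_assoc sc_add add_sc sc_sc sc_1 add_0 add_inverse)
      (auto simp: john_norm_def add_commute)
qed

end

context hom_bundle
begin

lemma hom_bundle_fibre: "x \<in> topspace (base E) \<Longrightarrow> hom_bundle_fibre E cj n x"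
  by (simp add: hom_bundle_fibre_def hom_bundle_fibre_axioms_def hom_bundle_axioms fibre_structure)

text \<open>In the coordinates given by \<open>b\<close>, the norm over \<open>x\<close> agrees up
  to the factor 1 + 2 * s, s = \<eta> * sqrt n, with the normalized norm over \<open>x0\<close>. The
  matrix \<open>W\<close> passes to John coordinates over \<open>x\<close>, so by
  \<open>john_stability\<close> it nearly preserves \<open>cnorm\<close>. That \<open>b\<close> is a
  basis is a consequence of the closeness.\<close>

lemma john_norm_near_comb:
  assumes x0: "x0 \<in> topspace (base E)" and x: "x \<in> topspace (base E)"
    and b: "\<And>i. i < n \<Longrightarrow> b i \<in> fibre E x"
    and near: "\<And>c. c \<in> csphere n \<Longrightarrow>
      \<bar>bnorm E (comb n x b c) - bnorm E (comb n x0 (john_basis x0) c)\<bar> < \<eta>"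
    and \<eta>: "0 < \<eta>" "\<eta> * sqrt n \<le> 1 / 2"
  shows "\<bar>john_norm (comb n x b c) - cnorm n c\<bar> \<le>
    sqrt (2 * n * ((1 + 2 * (\<eta> * sqrt n))\<^sup>2 - 1)) * cnorm n c"
proof -
  interpret a: hom_bundle_fibre E cj n x0 by (rule hom_bundle_fibre[OF x0])
  interpret hom_bundle_fibre E cj n x by (rule hom_bundle_fibre[OF x])
  define s where "s = \<eta> * sqrt n"
  have s: "0 \<le> s" "s \<le> 1 / 2" using \<eta> by (simp_all add: s_def)
  define \<nu> where "\<nu> c = bnorm E (comb n x0 (john_basis x0) c)" for c
  define \<nu>' where "\<nu>' c = bnorm E (comb n x b c)" for c
  interpret nu: coord_norm n \<nu>
    using a.coord_norm_john by (simp add: \<nu>_def[abs_def])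
  interpret nu': coord_seminorm n \<nu>'
    unfolding \<nu>'_def comb_lin using b by (rule coord_seminorm_lin)
  have john: "john n \<nu>" using john_basis(2)[OF x0] by (simp add: \<nu>_def[abs_def])
  \<comment> \<open>The estimate on the sphere extends by homogeneity; cnorm n c \<le> sqrt n *
    \<nu> c then makes the error relative to \<nu>.\<close>
  have diff: "\<bar>\<nu>' c - \<nu> c\<bar> \<le> s * \<nu> c" for c
  proof (cases "cnorm n c = 0")
    case True
    then have "c i = 0" if "i < n" for i
      using that by (simp add: cnorm_eq_0_iff)
    then have "\<nu> c = \<nu> (\<lambda>i. 0)" "\<nu>' c = \<nu>' (\<lambda>i. 0)"
      by (intro nu.cong nu'.cong; simp)+
    then show ?thesis by simp
  next
    case False
    let ?d = "\<lambda>i. if i < n then of_real (inverse (cnorm n c)) * c i else 0"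
    have "\<nu> ?d = \<nu> (\<lambda>i. of_real (inverse (cnorm n c)) * c i)"
      "\<nu>' ?d = \<nu>' (\<lambda>i. of_real (inverse (cnorm n c)) * c i)"
      by (auto intro: nu.cong nu'.cong)
    then have d: "\<nu> ?d = \<nu> c / cnorm n c" "\<nu>' ?d = \<nu>' c / cnorm n c"
      by (simp_all only: nu.scale nu'.scale) (simp_all add: norm_inverse norm_divide divide_inverse)
    have "\<bar>\<nu>' ?d - \<nu> ?d\<bar> < \<eta>"
      using near[OF csphere_normalize[OF False]] by (simp add: \<nu>_def \<nu>'_def)
    then have "\<bar>\<nu>' c - \<nu> c\<bar> / cnorm n c < \<eta>"
      unfolding d by (simp add: abs_divide flip: diff_divide_distrib)
    moreover have "cnorm n c > 0" using False cnorm_nonneg[of n c] by linarith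
    ultimately have "\<bar>\<nu>' c - \<nu> c\<bar> \<le> \<eta> * cnorm n c"
      by (simp add: field_simps)
    also have "\<dots> \<le> \<eta> * (sqrt n * \<nu> c)"
      using \<eta> john_cnorm_le[OF john nu.coord_norm_axioms, of c] by (intro mult_left_mono) auto
    finally show ?thesis by (simp add: s_def)
  qed
  define W where "W i j = coords n (john_basis x) (b j) i" for i j
  have "comb n x b c = comb n x (john_basis x) (mvec n W c)" for c
  proof -
    have "lin n b c = lin n (\<lambda>j. lin n (john_basis x) (\<lambda>i. W i j)) c"
      by (rule lin_cong) (use b basis_john in \<open>simp_all add: W_def lin_coords\<close>)
    then show ?thesis
      unfolding comb_lin using basis_john by (simp add: lin_mvec basisD)
  qed
  note comb_W = this
  \<comment> \<open>A kernel vector \<open>c\<close> of \<open>W\<close> has \<nu>' c = 0, hence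
    \<nu> c \<le> s * \<nu> c with s \<le> 1 / 2, which forces c = 0.\<close>
  obtain M where M: "is_inverse n W M"
  proof (rule injective_imp_inverse[of n W])
    fix c i assume c0: "\<And>i. i < n \<Longrightarrow> mvec n W c i = 0" and i: "i < n"
    have "\<nu>' c = bnorm E (comb n x (john_basis x) (\<lambda>i. 0))"
      unfolding \<nu>'_def comb_W
      by (rule arg_cong[where f = "bnorm E"]) (auto simp: comb_lin c0 intro: lin_cong)
    also have "\<dots> = 0"
      using coord_seminorm.zero[of n "\<lambda>c. bnorm E (comb n x (john_basis x) c)"] coord_norm_john
      by (simp add: coord_norm_def)
    finally have "\<nu> c \<le> s * \<nu> c" using diff[of c] by simp
    also have "\<dots> \<le> 1 / 2 * \<nu> c" using s by (intro mult_right_mono) auto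
    finally have "\<nu> c = 0" using nu.nonneg[of c] by simp
    then show "c i = 0" using i by (rule nu.eq_0)
  qed
  have M': "is_inverse n M W" using M by (rule is_inverse_sym)
  have "\<nu>' (mvec n M c) = bnorm E (comb n x (john_basis x) c)" for c
  proof -
    have "lin n (john_basis x) (mvec n W (mvec n M c)) = lin n (john_basis x) c"
      by (rule lin_cong) (auto simp: mvec_inverse[OF M])
    then show ?thesis by (simp add: \<nu>'_def comb_W) (simp add: comb_lin)
  qed
  then have john': "john n (\<lambda>c. \<nu>' (mvec n M c))"
    using john_basis(2)[OF x] by simp
  have "\<nu>' c \<le> (1 + 2 * s) * \<nu> c" "\<nu> c \<le> (1 + 2 * s) * \<nu>' c" for c
  proof -
    have "\<nu>' c \<le> (1 + s) * \<nu> c" using diff[of c] by (simp add: algebra_simps)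
    also have "\<dots> \<le> (1 + 2 * s) * \<nu> c" using s by (intro mult_right_mono) auto
    finally show "\<nu>' c \<le> (1 + 2 * s) * \<nu> c" .
    \<comment> \<open>For s \<le> 1 / 2 the factor 1 / (1 - s) is at most 1 + 2 * s.\<close>
    have "(1 + 2 * s) * (1 - s) - 1 = s * (1 - 2 * s)" by (simp add: algebra_simps)
    also have "\<dots> \<ge> 0" using s by simp
    finally have "1 * \<nu> c \<le> ((1 + 2 * s) * (1 - s)) * \<nu> c" by (intro mult_right_mono) auto
    also have "\<dots> = (1 + 2 * s) * ((1 - s) * \<nu> c)" by simp
    also have "\<dots> \<le> (1 + 2 * s) * \<nu>' c"
      using s diff[of c] by (intro mult_left_mono) (auto simp: algebra_simps)
    finally show "\<nu> c \<le> (1 + 2 * s) * \<nu>' c" by simp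
  qed
  from john_stability[OF john john' nu.coord_seminorm_axioms nu'.coord_seminorm_axioms M' _ this, of c]
  have "\<bar>(cnorm n (mvec n W c))\<^sup>2 - (cnorm n c)\<^sup>2\<bar>
      \<le> sqrt (2 * n * ((1 + 2 * s)\<^sup>2 - 1)) * cnorm n (mvec n W c) * cnorm n c"
    using s by simp
  moreover define D y r where "D = sqrt (2 * n * ((1 + 2 * s)\<^sup>2 - 1))" and "y = cnorm n (mvec n W c)"
    and "r = cnorm n c"
  ultimately have le: "\<bar>y\<^sup>2 - r\<^sup>2\<bar> \<le> D * y * r" by simp
  have pos: "0 \<le> y" "0 \<le> r" "0 \<le> D"
    using s by (simp_all add: y_def r_def D_def one_le_power)
  have "\<bar>y - r\<bar> \<le> D * r"
  proof (cases "y + r = 0")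
    case True
    then have "y = 0" "r = 0" using pos by linarith+
    then show ?thesis by simp
  next
    case False
    have "y\<^sup>2 - r\<^sup>2 = (y - r) * (y + r)"
      by (simp add: power2_eq_square algebra_simps)
    then have "\<bar>y - r\<bar> * (y + r) = \<bar>y\<^sup>2 - r\<^sup>2\<bar>"
      using pos by (simp add: abs_mult)
    \<comment> \<open>The bound D * y * r is enlarged to contain the factor y + r, which then
      cancels.\<close>
    also have "\<dots> \<le> D * r * (y + r)"
      using le mult_nonneg_nonneg[OF pos(3) zero_le_power2[of r]] by (simp add: algebra_simps power2_eq_square)
    finally show ?thesis using False pos by (simp add: mult_le_cancel_right)
  qed
  then show ?thesis
    unfolding comb_W john_norm_comb by (simp add: y_def r_def D_def s_def)
qed

text \<open>Replace the John basis over \<open>x0\<close> by vectors \<open>q i\<close> over a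
  nearby \<open>x\<close>, and \<open>p0\<close> by their combination v with the same coordinates
  \<open>c0\<close>. By \<open>john_norm_near_comb\<close> the John norm of v is close to that of
  \<open>p0\<close>; moreover p - v is small in the original norm, hence in the John norm. Both come
  from one use of \<open>bnorm_comb_nearby\<close> for the n + 1 vectors formed by the basis and
  \<open>p0\<close>.\<close>

lemma continuous_john_norm: "continuous_map (tot E) euclideanreal john_norm"
proof -
  have nbhd: "\<exists>V. openin (tot E) V \<and> p0 \<in> V \<and> (\<forall>p\<in>V. \<bar>john_norm p - john_norm p0\<bar> < \<epsilon>)"
    if p0: "p0 \<in> topspace (tot E)" and \<epsilon>: "\<epsilon> > 0" for p0 \<epsilon>
  proof -
    define x0 where "x0 = proj E p0"
    have x0: "x0 \<in> topspace (base E)" using p0 by (simp add: x0_def proj_in_base)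
    interpret a: hom_bundle_fibre E cj n x0 by (rule hom_bundle_fibre[OF x0])
    have p0f: "p0 \<in> fibre E x0" using p0 by (simp add: x0_def fibre_proj)
    define c0 where "c0 = john_coords p0"
    \<comment> \<open>The sum of the two errors: the distance of p from v, and the deviation of the
      John norm of v. It tends to 0 with \<eta>.\<close>
    define g where "g \<eta> = sqrt n * \<eta> + sqrt (2 * n * ((1 + 2 * (\<eta> * sqrt n))\<^sup>2 - 1)) * cnorm n c0" for \<eta>
    have "(g \<longlongrightarrow> g 0) (at_right 0)"
      unfolding g_def by (intro tendsto_intros)
    then have "\<forall>\<^sub>F \<eta> in at_right 0. g \<eta> < \<epsilon>"
      by (rule order_tendstoD(2)) (use \<epsilon> in \<open>simp add: g_def\<close>)
    moreover have "((\<lambda>\<eta>. \<eta> * sqrt n) \<longlongrightarrow> 0) (at_right 0)"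
      by (rule tendsto_mult_left_zero) (rule tendsto_ident_at)
    then have "\<forall>\<^sub>F \<eta> in at_right 0. \<eta> * sqrt n < 1 / 2"
      by (rule order_tendstoD(2)) simp
    moreover have "\<forall>\<^sub>F \<eta> in at_right 0. (0::real) < \<eta>"
      by (rule eventually_at_right_less)
    ultimately have "\<forall>\<^sub>F \<eta> in at_right 0. g \<eta> < \<epsilon> \<and> \<eta> * sqrt n < 1 / 2 \<and> 0 < \<eta>"
      by eventually_elim simp
    then obtain \<eta> where \<eta>: "g \<eta> < \<epsilon>" "\<eta> * sqrt n < 1 / 2" "0 < \<eta>"
      using eventually_happens trivial_limit_at_right_real by blast
    define e where "e i = (if i < n then john_basis x0 i else p0)" for i
    \<comment> \<open>These coefficients express the last vector minus the combination with
      coefficients \<open>c0\<close>; at \<open>e\<close> this is p0 - p0 = 0. On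
      \<open>csphere n\<close> the entry at index \<open>n\<close> is 0, so there the last vector
      drops out.\<close>
    define c1 :: "nat \<Rightarrow> 'k" where "c1 i = (if i < n then - c0 i else if i = n then 1 else 0)" for i
    have e: "e i \<in> fibre E x0" if "i < Suc n" for i
      using p0f a.basisD[OF a.basis_john] by (simp add: e_def)
    have K: "compact (insert c1 (csphere n))" by (intro compact_insert compact_csphere)
    obtain U W where
      U: "openin (base E) U" "x0 \<in> U" and
      W: "\<And>i. i < Suc n \<Longrightarrow> openin (tot E) (W i) \<and> e i \<in> W i" and
      near: "\<And>x b c. x \<in> U \<Longrightarrow> (\<And>i. i < Suc n \<Longrightarrow> b i \<in> W i \<inter> fibre E x) \<Longrightarrow>
        c \<in> insert c1 (csphere n) \<Longrightarrow>
        \<bar>bnorm E (comb (Suc n) x b c) - bnorm E (comb (Suc n) x0 e c)\<bar> < \<eta>"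
      by (rule bnorm_comb_nearby[OF x0 e K \<eta>(3)]) (assumption | blast)+
    have sphere: "comb (Suc n) x b c = comb n x b c"
      if "c \<in> csphere n" "x \<in> topspace (base E)" "\<And>i. i < Suc n \<Longrightarrow> b i \<in> fibre E x" for x b c
    proof -
      interpret fibre_structure "fibre E x" "badd E" "bscale E" "bzero E x" "bnorm E"
        using that(2) by (rule fibre_structure)
      have "c n = 0" using that(1) by (simp add: csphere_def)
      then show ?thesis
        unfolding comb_eq_lin[OF that(2)] lin_Suc using that(3) by (simp add: sc_0 add_0_right lin_closed)
    qed
    have diff: "comb (Suc n) x b c1 = badd E (b n) (bscale E (- 1) (comb n x b c0))"
      if "x \<in> topspace (base E)" "\<And>i. i < Suc n \<Longrightarrow> b i \<in> fibre E x" for x b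
    proof -
      interpret fibre_structure "fibre E x" "badd E" "bscale E" "bzero E x" "bnorm E"
        using that(1) by (rule fibre_structure)
      have "lin n b c1 = lin n b (\<lambda>i. (- 1) * c0 i)"
        by (rule lin_cong) (simp_all add: c1_def)
      also have "\<dots> = bscale E (- 1) (lin n b c0)"
        using that(2) by (intro lin_scale) simp
      finally show ?thesis
        unfolding comb_eq_lin[OF that(1)] lin_Suc using that(2)
        by (simp add: c1_def sc_1 add_commute sc_closed lin_closed)
    qed
    \<comment> \<open>Over \<open>R\<close> every \<open>W i\<close> meets the fibre, which supplies
      the vectors \<open>q i\<close>. Intersecting with the whole base keeps \<open>R\<close> open
      when n = 0.\<close>
    define R where "R = topspace (base E) \<inter> (\<Inter>i\<in>{..<n}. proj E ` W i)"
    define V where "V = {p \<in> topspace (tot E). proj E p \<in> U} \<inter> W n \<inter>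
      {p \<in> topspace (tot E). proj E p \<in> R}"
    have "openin (base E) (proj E ` W i)" if "i < n" for i
      using open_proj W[of i] that by (simp add: open_map_def)
    then have "openin (base E) R"
      unfolding R_def by (cases "n = 0") (auto intro!: openin_Int openin_INT2)
    then have "openin (tot E) V"
      unfolding V_def using U(1) W[of n]
      by (intro openin_Int openin_continuous_map_preimage[OF continuous_proj]) auto
    moreover have "p0 \<in> V"
    proof -
      have "x0 \<in> proj E ` W i" if "i < n" for i
        using W[of i] e[of i] that by (force simp: fibre_def)
      then show ?thesis using p0 U(2) W[of n] x0 by (auto simp: V_def R_def x0_def e_def)
    qed
    moreover have "\<bar>john_norm p - john_norm p0\<bar> < \<epsilon>" if p: "p \<in> V" for p
    proof -
      define x where "x = proj E p"
      have xU: "x \<in> topspace (base E)" "x \<in> U" and pW: "p \<in> W n" and pf: "p \<in> fibre E x"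
        using p by (auto simp: V_def R_def x_def fibre_def proj_in_base)
      interpret hom_bundle_fibre E cj n x by (rule hom_bundle_fibre[OF xU(1)])
      have "\<exists>q\<in>W i. proj E q = x" if "i < n" for i
      proof -
        have "proj E p \<in> proj E ` W i" using p that by (auto simp: V_def R_def)
        then show ?thesis by (auto simp: x_def)
      qed
      then obtain q where q: "\<And>i. i < n \<Longrightarrow> q i \<in> W i \<and> proj E (q i) = x" by metis
      define b where "b i = (if i < n then q i else p)" for i
      have b: "b i \<in> W i \<inter> fibre E x" if "i < Suc n" for i
        using that q[of i] W[of i] pW pf openin_subset[of "tot E" "W i"]
        by (cases "i = n") (auto simp: b_def fibre_def)
      have be: "comb n x0 e c = comb n x0 (john_basis x0) c" for c
        unfolding a.comb_lin by (rule a.lin_cong) (simp_all add: e_def)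
      have "\<bar>bnorm E (comb n x b c) - bnorm E (comb n x0 (john_basis x0) c)\<bar> < \<eta>"
        if "c \<in> csphere n" for c
        using near[OF xU(2), of b c] b e that sphere[OF that xU(1), of b] sphere[OF that x0, of e]
        by (simp add: be)
      then have 1: "\<bar>john_norm (comb n x b c0) - cnorm n c0\<bar> \<le>
          sqrt (2 * n * ((1 + 2 * (\<eta> * sqrt n))\<^sup>2 - 1)) * cnorm n c0"
        using b \<eta> by (intro john_norm_near_comb[OF x0 xU(1)]) auto
      have "comb (Suc n) x0 e c1 = badd E p0 (bscale E (- 1) p0)"
        using diff[OF x0 e] a.comb_john_coords[OF p0f] by (simp add: be c0_def) (simp add: e_def)
      then have "bnorm E (comb (Suc n) x0 e c1) = 0"
        using p0f x0 by (simp add: a.add_uminus bnorm_zero)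
      then have "bnorm E (badd E p (bscale E (- 1) (comb n x b c0))) < \<eta>"
        using near[OF xU(2), of b c1] b diff[OF xU(1), of b] by (simp add: b_def)
      then have 2: "sqrt n * bnorm E (badd E p (bscale E (- 1) (comb n x b c0))) \<le> sqrt n * \<eta>"
        by (intro mult_left_mono) auto
      have "comb n x b c0 \<in> fibre E x" using b by (intro comb_in_fibre[OF xU(1)]) auto
      from john_norm_diff[OF pf this]
      have "\<bar>john_norm p - john_norm (comb n x b c0)\<bar> \<le> sqrt n * \<eta>" using 2 by simp
      moreover have "john_norm p0 = cnorm n c0" by (simp add: john_norm_def c0_def)
      ultimately show ?thesis using 1 \<eta>(1) unfolding g_def by linarith
    qed
    ultimately show ?thesis by blast
  qed
  show ?thesis
    unfolding continuous_map_def
  proof (intro conjI allI impI)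
    fix S :: "real set" assume "openin euclideanreal S"
    then have S: "open S" by simp
    show "openin (tot E) {p \<in> topspace (tot E). john_norm p \<in> S}"
    proof (subst openin_subopen, safe)
      fix p0 assume p0: "p0 \<in> topspace (tot E)" "john_norm p0 \<in> S"
      then obtain \<epsilon> where \<epsilon>: "\<epsilon> > 0" "\<And>r. \<bar>r - john_norm p0\<bar> < \<epsilon> \<Longrightarrow> r \<in> S"
        using S unfolding open_dist dist_real_def by blast
      then obtain V where "openin (tot E) V" "p0 \<in> V" "\<forall>p\<in>V. \<bar>john_norm p - john_norm p0\<bar> < \<epsilon>"
        using nbhd[OF p0(1)] by blast
      then show "\<exists>T. openin (tot E) T \<and> p0 \<in> T \<and> T \<subseteq> {p \<in> topspace (tot E). john_norm p \<in> S}"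
        using \<epsilon>(2) openin_subset[of "tot E" V] by blast
    qed
  qed simp
qed

end

section \<open>The Hilbert renorming\<close>

context hom_bundle
begin

text \<open>Topology, projection and operations are kept, so every axiom that does not mention the
  norm is inherited.\<close>

definition hilbert_renorming :: "('x, 'e, 'k) bbundle" where
  "hilbert_renorming = E\<lparr>bnorm := john_norm\<rparr>"

lemma hilbert_renorming_simps [simp]:
  "base hilbert_renorming = base E" "tot hilbert_renorming = tot E"
  "proj hilbert_renorming = proj E" "badd hilbert_renorming = badd E"
  "bscale hilbert_renorming = bscale E" "bzero hilbert_renorming = bzero E"
  "bnorm hilbert_renorming = john_norm" "fibre hilbert_renorming x = fibre E x"
  by (simp_all add: hilbert_renorming_def fibre_def)

lemma homogeneous_hilbert_renorming: "homogeneous n hilbert_renorming"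
  using homogeneous by (simp add: homogeneous_def)

lemma bnorm_le_john_norm: "p \<in> topspace (tot E) \<Longrightarrow> bnorm E p \<le> john_norm p"
  using hom_bundle_fibre.bnorm_le_john_norm[OF hom_bundle_fibre[OF proj_in_base]] fibre_proj by blast

lemma john_norm_le: "p \<in> topspace (tot E) \<Longrightarrow> john_norm p \<le> sqrt n * bnorm E p"
  using hom_bundle_fibre.john_norm_le[OF hom_bundle_fibre[OF proj_in_base]] fibre_proj by blast

text \<open>Tubes for the new norm are open by continuity of \<open>john_norm\<close>, and they are
  contained in the tubes for the old norm because the new norm is the larger one.\<close>

lemma banach_bundle_hilbert_renorming: "banach_bundle hilbert_renorming"
proof -
  have "bzero E x \<in> tot E interior_of {p \<in> topspace (tot E). proj E p \<in> U \<and> john_norm p < \<epsilon>}"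
    if x: "x \<in> topspace (base E)" and U: "openin (base E) U" "x \<in> U" and \<epsilon>: "\<epsilon> > 0" for x U \<epsilon>
  proof -
    interpret hom_bundle_fibre E cj n x by (rule hom_bundle_fibre[OF x])
    have "openin (tot E) ({p \<in> topspace (tot E). proj E p \<in> U} \<inter> {p \<in> topspace (tot E). john_norm p \<in> {..<\<epsilon>}})"
      using U(1) openin_continuous_map_preimage[OF continuous_proj]
        openin_continuous_map_preimage[OF continuous_john_norm, of "{..<\<epsilon>}"]
      by (intro openin_Int) auto
    also have "{p \<in> topspace (tot E). proj E p \<in> U} \<inter> {p \<in> topspace (tot E). john_norm p \<in> {..<\<epsilon>}} =
        {p \<in> topspace (tot E). proj E p \<in> U \<and> john_norm p < \<epsilon>}"
      by auto
    finally have "openin (tot E) {p \<in> topspace (tot E). proj E p \<in> U \<and> john_norm p < \<epsilon>}" .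
    moreover have "bzero E x \<in> {p \<in> topspace (tot E). proj E p \<in> U \<and> john_norm p < \<epsilon>}"
      using U(2) \<epsilon> zero_closed john_norm_eq_0[OF zero_closed] by (simp add: fibre_def)
    ultimately show ?thesis by (simp add: interior_of_openin)
  qed
  moreover have "\<exists>U \<epsilon>. openin (base E) U \<and> x \<in> U \<and> \<epsilon> > 0 \<and>
      {p \<in> topspace (tot E). proj E p \<in> U \<and> john_norm p < \<epsilon>} \<subseteq> W"
    if "x \<in> topspace (base E)" "openin (tot E) W" "bzero E x \<in> W" for x W
  proof -
    from that(2,1,3) obtain U \<epsilon> where U: "openin (base E) U" "x \<in> U" "\<epsilon> > 0"
      "{p \<in> topspace (tot E). proj E p \<in> U \<and> bnorm E p < \<epsilon>} \<subseteq> W"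
      by (rule zero_neighbourhood)
    have "{p \<in> topspace (tot E). proj E p \<in> U \<and> john_norm p < \<epsilon>} \<subseteq> W"
      using bnorm_le_john_norm U(4) by (auto intro: le_less_trans)
    then show ?thesis using U by blast
  qed
  moreover have "banach_structure (fibre E x) (badd E) (bscale E) (bzero E x) john_norm"
    if "x \<in> topspace (base E)" for x
    using hom_bundle_fibre.banach_structure_john[OF hom_bundle_fibre[OF that]] .
  ultimately show ?thesis
    unfolding banach_bundle_def hilbert_renorming_simps
    using continuous_proj open_proj surj_proj continuous_bscale continuous_badd continuous_john_norm
      zero_in_fibre
    by (intro conjI ballI allI impI) auto
qed

lemma hilbert_bundle_hilbert_renorming: "hilbert_bundle cj hilbert_renorming"
  unfolding hilbert_bundle_def hilbert_renorming_simps
proof (intro conjI ballI)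
  fix x assume x: "x \<in> topspace (base E)"
  interpret hom_bundle_fibre E cj n x by (rule hom_bundle_fibre[OF x])
  let ?ip = "\<lambda>v w. ip n (john_coords v) (john_coords w)"
  show "\<exists>ip. (\<forall>p\<in>fibre E x. \<forall>q\<in>fibre E x. \<forall>r\<in>fibre E x. ip (badd E p q) r = ip p r + ip q r) \<and>
      (\<forall>a. \<forall>p\<in>fibre E x. \<forall>q\<in>fibre E x. ip (bscale E a p) q = a * ip p q) \<and>
      (\<forall>p\<in>fibre E x. \<forall>q\<in>fibre E x. ip q p = cj (ip p q)) \<and>
      (\<forall>p\<in>fibre E x. ip p p = of_real ((john_norm p)\<^sup>2))"
  proof (intro exI[of _ ?ip] conjI ballI allI)
    show "?ip (badd E p q) r = ?ip p r + ?ip q r" if "p \<in> fibre E x" "q \<in> fibre E x" for p q r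
      using that by (simp add: john_coords_add ip_def ring_distribs sum.distrib)
  qed (simp_all add: john_coords_scale ip_scale_left cj_ip ip_self john_norm_def)
qed (rule banach_bundle_hilbert_renorming)

section \<open>Bounded sections, supremum norms and operator norms\<close>

lemma bsectionsD:
  assumes "s \<in> bsections E" "x \<in> topspace (base E)"
  shows "s x \<in> topspace (tot E)"
  using assms by (auto simp: bsections_def continuous_map_def)

text \<open>Equivalent norms have the same bounded sections, so the identity induces a bijection of
  the section spaces.\<close>

lemma bsections_hilbert_renorming: "bsections hilbert_renorming = bsections E"
proof -
  have "(\<exists>B. \<forall>x\<in>topspace (base E). john_norm (s x) \<le> B) \<longleftrightarrow>
      (\<exists>B. \<forall>x\<in>topspace (base E). bnorm E (s x) \<le> B)"
    if "continuous_map (base E) (tot E) s" for s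
  proof safe
    have s: "s x \<in> topspace (tot E)" if "x \<in> topspace (base E)" for x
      using \<open>continuous_map (base E) (tot E) s\<close> that by (auto simp: continuous_map_def)
    show "\<exists>B. \<forall>x\<in>topspace (base E). bnorm E (s x) \<le> B"
      if "\<forall>x\<in>topspace (base E). john_norm (s x) \<le> B" for B
      using that bnorm_le_john_norm[OF s] order_trans by blast
    show "\<exists>B. \<forall>x\<in>topspace (base E). john_norm (s x) \<le> B"
      if "\<forall>x\<in>topspace (base E). bnorm E (s x) \<le> B" for B
      using that john_norm_le[OF s]
      by (intro exI[of _ "sqrt n * B"]) (meson mult_left_mono of_nat_0_le_iff order_trans real_sqrt_ge_zero)
  qed
  then show ?thesis by (auto simp: bsections_def)
qed

lemma induced_id: "s \<in> bsections E \<Longrightarrow> induced E (\<lambda>p. p) s = s"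
  by (auto simp: induced_def bsections_def fun_eq_iff)

lemma induced_inv_id: "s \<in> bsections E \<Longrightarrow> induced hilbert_renorming (inv_into (topspace (tot E)) (\<lambda>p. p)) s = s"
  using bsectionsD[of s] inv_into_f_f[of "\<lambda>p. p" "topspace (tot E)"]
  by (auto simp: induced_def bsections_def fun_eq_iff)

lemma bnorm_le_supnorm:
  assumes "s \<in> bsections F" "x \<in> topspace (base F)"
  shows "bnorm F (s x) \<le> supnorm F s"
  unfolding supnorm_def
proof (rule cSup_upper)
  obtain B where "\<forall>x\<in>topspace (base F). bnorm F (s x) \<le> B" using assms(1) by (auto simp: bsections_def)
  then show "bdd_above (insert 0 ((\<lambda>x. bnorm F (s x)) ` topspace (base F)))" by auto
qed (use assms(2) in auto)

lemma supnorm_nonneg: assumes "s \<in> bsections F" shows "0 \<le> supnorm F s"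
  unfolding supnorm_def
proof (rule cSup_upper)
  obtain B where "\<forall>x\<in>topspace (base F). bnorm F (s x) \<le> B" using assms by (auto simp: bsections_def)
  then show "bdd_above (insert 0 ((\<lambda>x. bnorm F (s x)) ` topspace (base F)))" by auto
qed auto

lemma supnorm_hilbert_renorming_le:
  assumes "s \<in> bsections E"
  shows "supnorm hilbert_renorming s \<le> sqrt n * supnorm E s"
  unfolding supnorm_def[of hilbert_renorming]
proof (rule cSup_least)
  fix r assume "r \<in> insert 0 ((\<lambda>x. bnorm hilbert_renorming (s x)) ` topspace (base hilbert_renorming))"
  then consider "r = 0" | x where "x \<in> topspace (base E)" "r = john_norm (s x)" by auto
  then show "r \<le> sqrt n * supnorm E s"
  proof cases
    case 1
    then show ?thesis using supnorm_nonneg[OF assms] by simp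
  next
    case 2
    then have "r \<le> sqrt n * bnorm E (s x)" using john_norm_le[OF bsectionsD[OF assms]] by simp
    also have "\<dots> \<le> sqrt n * supnorm E s"
      using bnorm_le_supnorm[OF assms] 2 by (intro mult_left_mono) auto
    finally show ?thesis .
  qed
qed simp

lemma supnorm_le_hilbert_renorming:
  assumes "s \<in> bsections E"
  shows "supnorm E s \<le> supnorm hilbert_renorming s"
  unfolding supnorm_def[of E]
proof (rule cSup_least)
  have s: "s \<in> bsections hilbert_renorming" using assms by (simp add: bsections_hilbert_renorming)
  fix r assume "r \<in> insert 0 ((\<lambda>x. bnorm E (s x)) ` topspace (base E))"
  then consider "r = 0" | x where "x \<in> topspace (base E)" "r = bnorm E (s x)" by auto
  then show "r \<le> supnorm hilbert_renorming s"
  proof cases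
    case 1
    then show ?thesis using supnorm_nonneg[OF s] by simp
  next
    case 2
    then have "r \<le> john_norm (s x)" using bnorm_le_john_norm[OF bsectionsD[OF assms]] by simp
    also have "\<dots> \<le> supnorm hilbert_renorming s"
      using bnorm_le_supnorm[OF s] 2 by simp
    finally show ?thesis .
  qed
qed simp

lemma opnorm_le:
  assumes "0 \<le> C" "\<And>s. s \<in> bsections F \<Longrightarrow> supnorm F' (T s) \<le> C * supnorm F s"
  shows "opnorm F F' T \<le> C" "0 \<le> opnorm F F' T"
proof -
  have le: "r \<le> C" if "r \<in> insert 0 {supnorm F' (T s) |s. s \<in> bsections F \<and> supnorm F s \<le> 1}" for r
    using that
  proof safe
    fix s assume "s \<in> bsections F" "supnorm F s \<le> 1"
    then show "supnorm F' (T s) \<le> C"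
      using assms(2)[of s] mult_left_mono[of "supnorm F s" 1 C] assms(1) by simp
  qed (rule assms(1))
  then show "opnorm F F' T \<le> C" unfolding opnorm_def by (intro cSup_least) auto
  show "0 \<le> opnorm F F' T"
    unfolding opnorm_def using le by (intro cSup_upper bdd_aboveI[of _ C]) auto
qed

lemma bBM_value_hilbert_renorming: "\<exists>r\<in>bBM_values E hilbert_renorming. r \<le> sqrt n"
proof -
  let ?id = "\<lambda>p :: 'e. p" and ?inv = "inv_into (topspace (tot E)) (\<lambda>p. p)"
  have 1: "supnorm hilbert_renorming (induced E ?id s) \<le> sqrt n * supnorm E s" if "s \<in> bsections E" for s
    using supnorm_hilbert_renorming_le that by (simp add: induced_id)
  have 2: "supnorm E (induced hilbert_renorming ?inv s) \<le> 1 * supnorm hilbert_renorming s"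
    if "s \<in> bsections hilbert_renorming" for s
    using supnorm_le_hilbert_renorming that by (simp add: induced_inv_id bsections_hilbert_renorming)
  have "renorming E hilbert_renorming ?id"
    by (simp add: renorming_def homeomorphic_map_id[unfolded id_def])
  moreover have "bij_betw (induced E ?id) (bsections E) (bsections hilbert_renorming)"
    unfolding bsections_hilbert_renorming by (auto simp: bij_betw_def inj_on_def induced_id)
  moreover have "bounded_op E hilbert_renorming (induced E ?id)"
    using 1 unfolding bounded_op_def by blast
  moreover have "bounded_op hilbert_renorming E (induced hilbert_renorming ?inv)"
    using 2 unfolding bounded_op_def by blast
  ultimately have "opnorm E hilbert_renorming (induced E ?id) *
      opnorm hilbert_renorming E (induced hilbert_renorming ?inv) \<in> bBM_values E hilbert_renorming"
    unfolding bBM_values_def by blast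
  moreover have "opnorm E hilbert_renorming (induced E ?id) *
      opnorm hilbert_renorming E (induced hilbert_renorming ?inv) \<le> sqrt n * 1"
    using opnorm_le[of "sqrt n", OF _ 1] opnorm_le[of 1, OF _ 2] by (intro mult_mono) auto
  ultimately show ?thesis by auto
qed

text \<open>The norms of the identity and its inverse are at most sqrt n and 1. The infimum of the
  values can be 0, for instance over an empty base; then \<open>eln\<close> returns minus
  infinity.\<close>

lemma dbBM_hilbert_renorming: "dbBM E hilbert_renorming \<le> ereal (ln (real n) / 2)"
proof -
  obtain r where r: "r \<in> bBM_values E hilbert_renorming" "r \<le> sqrt n"
    using bBM_value_hilbert_renorming by blast
  then have "Inf (ereal ` bBM_values E hilbert_renorming) \<le> ereal r" by (intro INF_lower)
  then have le: "Inf (ereal ` bBM_values E hilbert_renorming) \<le> ereal (sqrt n)"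
    using r(2) by (simp add: order_trans)
  show ?thesis
  proof (cases "Inf (ereal ` bBM_values E hilbert_renorming)")
    case (real c)
    show ?thesis
    proof (cases "c \<le> 0")
      case False
      have "c \<le> sqrt n" using le real by simp
      then have "ln c \<le> ln (sqrt n)" using False by (intro ln_mono) auto
      \<comment> \<open>For n = 0 the bound c \<le> sqrt 0 contradicts 0 < c, so the value of
        \<open>ln 0\<close> never enters.\<close>
      then show ?thesis
        using real False \<open>c \<le> sqrt n\<close> by (cases "n = 0") (auto simp: dbBM_def eln_def ln_sqrt)
    qed (simp add: dbBM_def eln_def real)
  qed (use le in \<open>auto simp: dbBM_def eln_def\<close>)
qed

text \<open>The infimum ranges over bundles of the same type as \<open>E\<close>; the renorming
  keeps the total space and is one of them.\<close>

lemma INF_dbBM_le: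
  "(INF E' \<in> {E' :: ('x, 'e, 'k) bbundle. hilbert_bundle cj E' \<and> homogeneous n E' \<and> base E' = base E}.
      dbBM E E') \<le> ereal (ln (real n) / 2)"
proof (rule INF_lower2)
  show "hilbert_renorming \<in> {E'. hilbert_bundle cj E' \<and> homogeneous n E' \<and> base E' = base E}"
    by (simp add: hilbert_bundle_hilbert_renorming homogeneous_hilbert_renorming)
qed (rule dbBM_hilbert_renorming)

end

lemma conj_field_real: "conj_field (\<lambda>a :: real. a)"
  by unfold_locales (auto simp: power2_eq_square)

lemma conj_field_complex: "conj_field cnj"
proof
  show "a * cnj a = of_real ((norm a)\<^sup>2)" for a
    by (rule complex_norm_square[symmetric])
qed simp_all

theorem theorem1p9:
  shows "(\<forall>(E :: ('x, 'e, real) bbundle) n.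
            Hausdorff_space (base E) \<and> locally_paracompact (base E) \<and>
            banach_bundle E \<and> homogeneous n E \<longrightarrow>
            (INF E' \<in> {E' :: ('x, 'e, real) bbundle. hilbert_bundle (\<lambda>a. a) E' \<and>
                         homogeneous n E' \<and> base E' = base E}. dbBM E E')
              \<le> ereal (ln (real n) / 2)) \<and>
         (\<forall>(E :: ('x, 'e, complex) bbundle) n.
            Hausdorff_space (base E) \<and> locally_paracompact (base E) \<and>
            banach_bundle E \<and> homogeneous n E \<longrightarrow>
            (INF E' \<in> {E' :: ('x, 'e, complex) bbundle. hilbert_bundle cnj E' \<and>
                         homogeneous n E' \<and> base E' = base E}. dbBM E E')
              \<le> ereal (ln (real n) / 2))"
proof (intro conjI allI impI; elim conjE)
  fix E :: "('x, 'e, real) bbundle" and n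
  assume "banach_bundle E" "homogeneous n E"
  then have "hom_bundle E (\<lambda>a. a) n"
    by (intro hom_bundle.intro hom_bundle_axioms.intro fbundle.intro conj_field_real)
  then show "(INF E' \<in> {E' :: ('x, 'e, real) bbundle. hilbert_bundle (\<lambda>a. a) E' \<and>
      homogeneous n E' \<and> base E' = base E}. dbBM E E') \<le> ereal (ln (real n) / 2)"
    by (rule hom_bundle.INF_dbBM_le)
next
  fix E :: "('x, 'e, complex) bbundle" and n
  assume "banach_bundle E" "homogeneous n E"
  then have "hom_bundle E cnj n"
    by (intro hom_bundle.intro hom_bundle_axioms.intro fbundle.intro conj_field_complex)
  then show "(INF E' \<in> {E' :: ('x, 'e, complex) bbundle. hilbert_bundle cnj E' \<and>
      homogeneous n E' \<and> base E' = base E}. dbBM E E') \<le> ereal (ln (real n) / 2)"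
    by (rule hom_bundle.INF_dbBM_le)
qed

end
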